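(* Let $G$ be a locally compact Abelian $T_0$-topological group having a countable basis of its topology. Let $x\in G$ with $x\neq e$. Let $\{X_{n,k}:n\in\mathbb{N},\ k=1,\ldots,K_n\}$ be an array of random elements in $G$ such that for each $n$ the elements $X_{n,1},\ldots,X_{n,K_n}$ are independent and identically distributed, $K_n\to\infty$, $$\mathrm{P}(X_{n,k}=x)=p_n,\qquad \mathrm{P}(X_{n,k}=e)=1-p_n,$$ and $p_n\to0$. Then the array is infinitesimal. Moreover, if $\lambda$ is a nonnegative real number, then the distribution of $\sum_{k=1}^{K_n}X_{n,k}$ converges weakly to $\mathrm{e}(\lambda\delta_x)$ as $n\to\infty$ if and only if $K_n p_n\to\lambda$. If the smallest closed subgroup $H$ of $G$ containing $x$ is compact, then the distribution of $\sum_{k=1}^{K_n}X_{n,k}$ converges weakly to $\omega_H$ as $n\to\infty$ if and only if $K_n p_n\to\infty$.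
   Context: $G$ is written additively, with identity $e$. $\mathbb{N}$ is the set of positive integers. $\delta_x$ is the Dirac measure at $x$. A Borel neighbourhood of $e$ is a Borel set $U\subset G$ containing an open set that contains $e$. The array is infinitesimal if $\lim_{n\to\infty}\max_{1\le k\le K_n}\mathrm{P}(X_{n,k}\in G\setminus U)=0$ for every Borel neighbourhood $U$ of $e$. For a bounded measure $\eta$ on $G$, the compound Poisson measure is the probability measure $\mathrm{e}(\eta):=\exp(-\eta(G))\left(\delta_e+\eta+\frac{\eta*\eta}{2!}+\frac{\eta*\eta*\eta}{3!}+\cdots\right)$, where $*$ is convolution. For a compact subgroup $H$ of $G$, $\omega_H$ is the normalized Haar measure on $H$, considered as a probability measure on $G$. *)

theory Defs
  imports "HOL-Probability.Probability"
begin

text \<open>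
  The group is a type: of class \<open>topological_ab_group_add\<close> (neutral element \<open>0\<close>) with the \<open>T\<^sub>0\<close> and
  second countability axioms as further sorts. Measures on the group are measures on its Borel
  sets.
\<close>

definition is_subgroup :: "'a::ab_group_add set \<Rightarrow> bool" where
  "is_subgroup H \<longleftrightarrow> 0 \<in> H \<and> (\<forall>a\<in>H. \<forall>b\<in>H. a + b \<in> H) \<and> (\<forall>a\<in>H. - a \<in> H)"

definition smallest_closed_subgroup :: "'a::topological_ab_group_add \<Rightarrow> 'a set" where
  "smallest_closed_subgroup x = (\<lambda>H. closed H \<and> is_subgroup H) hull {x}"

definition weakly_converges ::
    "(nat \<Rightarrow> 'a::topological_space measure) \<Rightarrow> 'a measure \<Rightarrow> bool" where
  "weakly_converges \<mu> \<nu> \<longleftrightarrow>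
     (\<forall>f::'a \<Rightarrow> real. continuous_on UNIV f \<and> bounded (range f) \<longrightarrow>
        (\<lambda>n. integral\<^sup>L (\<mu> n) f) \<longlonglongrightarrow> integral\<^sup>L \<nu> f)"

text \<open>
  The library constant \<^const>\<open>convolution\<close> is available for Euclidean spaces only; this is the same
  definition on topological groups.
\<close>

definition group_convolution ::
    "'a::topological_ab_group_add measure \<Rightarrow> 'a measure \<Rightarrow> 'a measure" where
  "group_convolution \<mu> \<nu> = distr (\<mu> \<Otimes>\<^sub>M \<nu>) borel (\<lambda>(a, b). a + b)"

primrec convolution_power ::
    "'a::topological_ab_group_add measure \<Rightarrow> nat \<Rightarrow> 'a measure" where
  "convolution_power \<eta> 0 = return borel 0"
| "convolution_power \<eta> (Suc j) = group_convolution \<eta> (convolution_power \<eta> j)"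

definition compound_poisson :: "'a::topological_ab_group_add measure \<Rightarrow> 'a measure" where
  "compound_poisson \<eta> = measure_of UNIV (sets borel)
     (\<lambda>A. ennreal (exp (- measure \<eta> UNIV)) * (\<Sum>j. emeasure (convolution_power \<eta> j) A / fact j))"

text \<open>
  Normalized Haar measure on the subgroup \<open>H\<close>, regarded as a measure on the whole group: it is
  carried by \<open>H\<close>. The description determines a measure when \<open>H\<close> is compact (and the group
  is Hausdorff and second countable, so that \<open>H\<close> is a Borel set and regularity is automatic); for
  other \<open>H\<close> the value is not meaningful.
\<close>

definition is_normalized_haar :: "'a::topological_ab_group_add set \<Rightarrow> 'a measure \<Rightarrow> bool" where
  "is_normalized_haar H \<mu> \<longleftrightarrow> sets \<mu> = sets borel \<and> prob_space \<mu> \<and> emeasure \<mu> H = 1 \<and>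
     (\<forall>h\<in>H. \<forall>A\<in>sets borel. A \<subseteq> H \<longrightarrow> emeasure \<mu> ((\<lambda>a. h + a) ` A) = emeasure \<mu> A)"

definition haar_measure :: "'a::topological_ab_group_add set \<Rightarrow> 'a measure" where
  "haar_measure H = (THE \<mu>. is_normalized_haar H \<mu>)"

definition borel_nhd_zero :: "'a::topological_ab_group_add set \<Rightarrow> bool" where
  "borel_nhd_zero U \<longleftrightarrow> U \<in> sets borel \<and> (\<exists>V. open V \<and> 0 \<in> V \<and> V \<subseteq> U)"

text \<open>
  Rows of an array are indexed by the positive integers. A row of length \<open>K n = 0\<close> leaves the
  maximum unspecified, which does not affect the limit as soon as \<open>K\<close> is eventually positive.
\<close>

definition infinitesimal_array ::
    "'b measure \<Rightarrow> (nat \<Rightarrow> nat) \<Rightarrow> (nat \<Rightarrow> nat \<Rightarrow> 'b \<Rightarrow> 'a::topological_ab_group_add) \<Rightarrow> bool" where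
  "infinitesimal_array M K X \<longleftrightarrow>
     (\<forall>U. borel_nhd_zero U \<longrightarrow>
        (\<lambda>n. MAX k\<in>{1..K n}. measure M {\<omega> \<in> space M. X n k \<omega> \<in> - U}) \<longlonglongrightarrow> 0)"

lemma sets_convolution_power [simp]: "sets (convolution_power \<eta> j) = sets borel"
  by (cases j) (simp_all add: group_convolution_def)

lemma sets_compound_poisson [simp]: "sets (compound_poisson \<eta>) = sets borel"
  using sets.sigma_sets_eq[of borel] by (simp add: compound_poisson_def)

lemma emeasure_compound_poisson:
  assumes "A \<in> sets borel"
  shows "emeasure (compound_poisson \<eta>) A =
    ennreal (exp (- measure \<eta> UNIV)) * (\<Sum>j. emeasure (convolution_power \<eta> j) A / fact j)"
proof -
  let ?f = "\<lambda>A. ennreal (exp (- measure \<eta> UNIV)) *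
    (\<Sum>j. emeasure (convolution_power \<eta> j) A / fact j)"
  have swap: "(\<Sum>i. \<Sum>j. g i j) = (\<Sum>j. \<Sum>i. g i j)" for g :: "nat \<Rightarrow> nat \<Rightarrow> ennreal"
    using nn_integral_suminf[of "\<lambda>j i. g i j" "count_space UNIV"]
    by (simp add: nn_integral_count_space_nat)
  have "countably_additive (sets borel) ?f"
  proof (rule countably_additiveI)
    fix B :: "nat \<Rightarrow> 'a set"
    assume B: "range B \<subseteq> sets borel" and d: "disjoint_family B"
    have "(\<Sum>i. emeasure (convolution_power \<eta> j) (B i) / fact j) =
        emeasure (convolution_power \<eta> j) (\<Union>i. B i) / fact j" for j
      using B d by (simp add: divide_ennreal_def suminf_emeasure)
    then show "(\<Sum>i. ?f (B i)) = ?f (\<Union>i. B i)"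
      by (subst ennreal_suminf_cmult, subst swap) simp
  qed
  moreover have "positive (sets borel) ?f"
    by (simp add: positive_def)
  moreover have "sigma_algebra UNIV (sets (borel :: 'a measure))"
    using sets.sigma_algebra_axioms[of "borel :: 'a measure"] by simp
  ultimately show ?thesis
    unfolding compound_poisson_def using assms by (intro emeasure_measure_of_sigma)
qed

end

theory Submission
  imports Defs
begin

text \<open>
  The row sums are distributed like \<open>N x\<close> with \<open>N\<close> binomial, so everything depends on the limit
  points of \<open>K\<^sub>n p\<^sub>n\<close> in \<open>[0, \<infinity>]\<close>. Along a subsequence with a finite limit \<open>c\<close> the Poisson limit
  theorem gives \<open>e(c \<delta>\<^sub>x)\<close>. Along a subsequence with limit \<open>\<infinity>\<close> the laws of \<open>N\<close> and \<open>N + 1\<close> become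
  indistinguishable, so every weak limit is invariant under translation by \<open>x\<close>, hence under the
  closed subgroup generated by \<open>x\<close>; if that subgroup is compact, limits exist and are Haar measure.
  Finally \<open>e(c \<delta>\<^sub>x)\<close> is never invariant under \<open>x\<close> and determines \<open>c\<close>, which a character of the
  discrete cyclic group generated by \<open>x\<close> detects.
\<close>

text \<open>The type offers only the T0 axiom and a countable base, so what is familiar from metric
  spaces is derived from regularity, which translations provide: Hausdorff separation, Urysohn
  functions, and the fact that bounded continuous functions determine a Borel measure. The
  probability theory takes place on the naturals. A test function \<open>f\<close> on the group
  enters only as the bounded sequence \<open>f (multiple k x)\<close>, and both the Poisson limit
  and the comparison of \<open>N\<close> with \<open>N + 1\<close> hold for arbitrary bounded
  sequences; hence it does not matter whether the multiples of \<open>x\<close> coincide, accumulate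
  or stay apart. \<open>haar_measure\<close> is a definite description, so existence and uniqueness
  must both be supplied. Existence comes from the binomial laws themselves, as a weak limit for one
  convenient choice of \<open>K\<close> and \<open>p\<close>.\<close>

section \<open>Borel measures on regular second countable spaces\<close>

text \<open>The continuous map taking \<open>(u, v)\<close> to \<open>a + u - v\<close> sends
  \<open>(0, 0)\<close> to \<open>a\<close>, which is outside \<open>C\<close>. If it avoids
  \<open>C\<close> on \<open>A \<times> B\<close>, the translates \<open>a + A\<close> and
  \<open>C + B\<close> are disjoint, since a common point \<open>a + u = c + v\<close> would give
  \<open>c = a + u - v\<close>.\<close>

lemma regular_space_topological_group:
  "regular_space (euclidean :: 'a::topological_group_add topology)"
  unfolding regular_space_def
proof (intro allI impI)
  fix C :: "'a set" and a
  assume "closedin euclidean C \<and> a \<in> topspace euclidean - C"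
  then have C: "closed C" and a: "a \<notin> C"
    by auto
  have "continuous_on UNIV (\<lambda>z. a + fst z - snd z :: 'a)"
    by (intro continuous_intros)
  then have "open ((\<lambda>z. a + fst z - snd z) -` (- C))"
    using C by (intro open_vimage) auto
  then obtain A B where A: "open A" and B: "open B" and 0: "(0, 0) \<in> A \<times> B"
    and AB: "A \<times> B \<subseteq> (\<lambda>z. a + fst z - snd z) -` (- C)"
    by (rule open_prod_elim[where x = "(0, 0)"]) (use a in auto)
  define U where "U = (\<lambda>y. - a + y) -` A"
  define V where "V = (\<Union>c\<in>C. (\<lambda>y. - c + y) -` B)"
  have "open U" "open V"
    unfolding U_def V_def using A B
    by (auto intro!: open_vimage continuous_intros)
  moreover have "a \<in> U" "C \<subseteq> V"
    using 0 by (auto simp: U_def V_def)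
  moreover have "disjnt U V"
  proof -
    have False if y: "- a + y \<in> A" "- c + y \<in> B" and c: "c \<in> C" for y c
    proof -
      have "a + (- a + y) - (- c + y) = c"
        by (simp add: diff_conv_add_uminus minus_add add.assoc del: add_uminus_conv_diff)
      then show False
        using AB y c by fastforce
    qed
    then show ?thesis
      by (auto simp: disjnt_def U_def V_def)
  qed
  ultimately show "\<exists>U V. openin euclidean U \<and> openin euclidean V \<and> a \<in> U \<and> C \<subseteq> V \<and> disjnt U V"
    by (metis open_openin)
qed

text \<open>An open set \<open>W\<close> contains exactly one of two distinct points; regularity
  separates that point from the complement of \<open>W\<close>, where the other one lies.\<close>

lemma Hausdorff_space_regular_t0:
  assumes "regular_space (euclidean :: 'a::t0_space topology)"
  shows "Hausdorff_space (euclidean :: 'a topology)"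
proof -
  have "\<exists>U V. open U \<and> open V \<and> x \<in> U \<and> y \<in> V \<and> disjnt U V" if "x \<noteq> y" for x y :: 'a
  proof -
    obtain W where W: "open W" "x \<in> W \<and> y \<notin> W \<or> y \<in> W \<and> x \<notin> W"
      using t0_space_class.t0_space[OF \<open>x \<noteq> y\<close>] by blast
    have "\<exists>U V. open U \<and> open V \<and> p \<in> U \<and> q \<in> V \<and> disjnt U V" if "p \<in> W" "q \<notin> W" for p q
      using assms[unfolded regular_space_def, rule_format, of "- W" p] that W(1)
      by (auto simp: closed_closedin[symmetric] open_openin[symmetric] closed_Compl)
    then show ?thesis
      using W(2) by (metis disjnt_sym)
  qed
  then show ?thesis
    by (simp add: Hausdorff_space_def)
qed

lemma countable_base_sequence:
  obtains B :: "nat \<Rightarrow> 'a::second_countable_topology set"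
  where "\<And>i. open (B i)" "\<And>S x. open S \<Longrightarrow> x \<in> S \<Longrightarrow> \<exists>i. x \<in> B i \<and> B i \<subseteq> S"
proof -
  obtain \<B> :: "'a set set" where \<B>: "countable \<B>" "topological_basis \<B>"
    using ex_countable_basis by blast
  \<comment> \<open>The empty set is inserted because the range of \<open>from_nat_into\<close> is
    the given countable set only if that set is nonempty.\<close>
  define B where "B = from_nat_into (insert {} \<B>)"
  have range: "range B = insert {} \<B>"
    using \<B>(1) by (simp add: B_def range_from_nat_into)
  show ?thesis
  proof
    fix i
    show "open (B i)"
      using range \<B>(2) by (metis insertE open_empty rangeI topological_basis_open)
  next
    fix S :: "'a set" and x assume "open S" "x \<in> S"
    then obtain U where "U \<in> \<B>" "x \<in> U" "U \<subseteq> S"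
      using \<B>(2) by (meson topological_basisE)
    then show "\<exists>i. x \<in> B i \<and> B i \<subseteq> S"
      using range by (metis imageE insertCI)
  qed
qed

lemma second_countable_euclidean:
  "second_countable (euclidean :: 'a::second_countable_topology topology)"
proof -
  obtain \<B> :: "'a set set" where "countable \<B>" "topological_basis \<B>"
    using ex_countable_basis by blast
  then show ?thesis
    unfolding second_countable_def
    by (metis open_openin topological_basisE topological_basis_open)
qed

text \<open>A regular space with a countable base is Lindelof, hence normal. Urysohn functions that
  are 0 off \<open>U\<close> and 1 on growing finite unions of closures of basic sets inside
  \<open>U\<close> converge to the indicator, because regularity puts every point of
  \<open>U\<close> into one of these closures.\<close>

lemma open_indicator_limit_continuous:
  fixes U :: "'a::second_countable_topology set"
  assumes reg: "regular_space (euclidean :: 'a topology)" and U: "open U"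
  obtains f :: "nat \<Rightarrow> 'a \<Rightarrow> real"
  where "\<And>n. continuous_on UNIV (f n)" "\<And>n x. f n x \<in> {0..1}"
    "\<And>x. (\<lambda>n. f n x) \<longlonglongrightarrow> indicator U x"
proof -
  obtain B :: "nat \<Rightarrow> 'a set" where B: "\<And>i. open (B i)"
      "\<And>S x. open S \<Longrightarrow> x \<in> S \<Longrightarrow> \<exists>i. x \<in> B i \<and> B i \<subseteq> S"
    by (rule countable_base_sequence) blast
  define F where "F n = (\<Union>i\<in>{i. i \<le> n \<and> closure (B i) \<subseteq> U}. closure (B i))" for n
  have "normal_space (euclidean :: 'a topology)"
    using reg regular_Lindelof_imp_normal_space second_countable_euclidean
      second_countable_imp_Lindelof_space by blast
  moreover have "closed (- U)" "closed (F n)" "- U \<inter> F n = {}" for n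
    using U by (auto simp: F_def closed_Compl)
  ultimately have "\<exists>f::'a\<Rightarrow>real. continuous_map euclidean (top_of_set {0..1}) f \<and>
      f ` (- U) \<subseteq> {0} \<and> f ` F n \<subseteq> {1}" for n
    unfolding normal_space_iff_Urysohn disjnt_def closed_closedin[symmetric] by blast
  then obtain f :: "nat \<Rightarrow> 'a \<Rightarrow> real" where
    f: "\<And>n. continuous_map euclidean (top_of_set {0..1}) (f n)"
      "\<And>n. f n ` (- U) \<subseteq> {0}" "\<And>n. f n ` F n \<subseteq> {1}"
    by metis
  show ?thesis
  proof
    fix n
    show "continuous_on UNIV (f n)"
      using f(1)[of n] continuous_map_into_fulltopology by force
    fix x show "f n x \<in> {0..1}"
      using f(1)[of n] by (auto simp: continuous_map_def)
  next
    fix x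
    show "(\<lambda>n. f n x) \<longlonglongrightarrow> indicator U x"
    proof (cases "x \<in> U")
      case True
      obtain V W where VW: "open V" "closed W" "x \<in> V" "V \<subseteq> W" "W \<subseteq> U"
        using reg True U unfolding neighbourhood_base_of_closedin[symmetric] neighbourhood_base_of
        by (metis closed_closedin open_openin)
      obtain i where i: "x \<in> B i" "B i \<subseteq> V"
        using B(2) VW by blast
      have "closure (B i) \<subseteq> U"
        using i VW by (meson closure_minimal order_trans)
      then have "x \<in> F n" if "n \<ge> i" for n
        using that i closure_subset unfolding F_def by blast
      then have "f n x = 1" if "n \<ge> i" for n
        using f(3)[of n] that by blast
      then have "eventually (\<lambda>n. f n x = 1) sequentially"
        by (auto simp: eventually_sequentially)
      then show ?thesis
        using True tendsto_eventually by force
    next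
      case False
      then have "f n x = 0" for n
        using f(2)[of n] by blast
      then show ?thesis
        using False by simp
    qed
  qed
qed

text \<open>Gives uniqueness of weak limits. By dominated convergence the measures agree on open
  sets, an intersection-stable generator of the Borel sets.\<close>

lemma measure_eqI_bounded_continuous:
  fixes \<mu> \<nu> :: "'a::second_countable_topology measure"
  assumes reg: "regular_space (euclidean :: 'a topology)"
    and fin: "finite_measure \<mu>" "finite_measure \<nu>"
    and sets [measurable_cong]: "sets \<mu> = sets borel" "sets \<nu> = sets borel"
    and eq: "\<And>f::'a \<Rightarrow> real. continuous_on UNIV f \<Longrightarrow> bounded (range f) \<Longrightarrow>
      integral\<^sup>L \<mu> f = integral\<^sup>L \<nu> f"
  shows "\<mu> = \<nu>"
proof -
  interpret \<mu>: finite_measure \<mu> by fact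
  interpret \<nu>: finite_measure \<nu> by fact
  have open_eq: "emeasure \<mu> U = emeasure \<nu> U" if U: "open U" for U
  proof -
    obtain f :: "nat \<Rightarrow> 'a \<Rightarrow> real"
      where f: "\<And>n. continuous_on UNIV (f n)" "\<And>n x. f n x \<in> {0..1}"
        "\<And>x. (\<lambda>n. f n x) \<longlonglongrightarrow> indicator U x"
      using open_indicator_limit_continuous[OF reg U] by blast
    have [measurable]: "f n \<in> borel_measurable borel" for n
      by (rule borel_measurable_continuous_onI[OF f(1)])
    have bd: "bounded (range (f n))" for n
      using f(2) by (intro boundedI[of _ 1]) auto
    have U' [measurable]: "U \<in> sets borel"
      using U by simp
    have lim: "(\<lambda>n. integral\<^sup>L M (f n)) \<longlonglongrightarrow> measure M U"
      if "finite_measure M" and [measurable_cong]: "sets M = sets borel" for M :: "'a measure"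
    proof -
      interpret finite_measure M by fact
      have "(\<lambda>n. integral\<^sup>L M (f n)) \<longlonglongrightarrow> integral\<^sup>L M (indicator U)"
        using f(2,3) by (intro integral_dominated_convergence[where w = "\<lambda>_. 1"]) auto
      then show ?thesis
        using sets_eq_imp_space_eq[OF that(2)] by simp
    qed
    have "measure \<mu> U = measure \<nu> U"
      using lim[OF fin(1) sets(1)] lim[OF fin(2) sets(2)] unfolding eq[OF f(1) bd]
      by (rule LIMSEQ_unique)
    then show ?thesis
      by (simp add: \<mu>.emeasure_eq_measure \<nu>.emeasure_eq_measure)
  qed
  show ?thesis
  proof (rule measure_eqI_generator_eq[where E = "Collect open" and \<Omega> = UNIV and A = "\<lambda>_. UNIV"])
    show "sets \<mu> = sigma_sets UNIV (Collect open)" "sets \<nu> = sigma_sets UNIV (Collect open)"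
      by (simp_all add: sets borel_def)
  qed (auto simp: Int_stable_def open_eq)
qed

section \<open>Weak compactness over a compact set\<close>

text \<open>Binary sequences are read in base 3: the tail after position \<open>n\<close>
  contributes at most half of \<open>(1/3) ^ n\<close>, so the first differing digit decides and
  \<open>e\<close> is strictly increasing for the lexicographic order. In base 2 the tail could
  compensate for the digit.\<close>

lemma Cantor_space_embedding:
  obtains e :: "(nat \<Rightarrow> bool) \<Rightarrow> real" where "continuous_on UNIV e" "inj e"
proof
  define g :: "nat \<Rightarrow> (nat \<Rightarrow> bool) \<Rightarrow> real" where "g i s = of_bool (s i) * (1/3) ^ i" for i s
  define e where "e s = (\<Sum>i. g i s)" for s
  have sm: "summable (\<lambda>i. (1/3::real) ^ i)"
    by (simp add: summable_geometric)
  have g: "0 \<le> g i s" "g i s \<le> (1/3) ^ i" for i s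
    by (auto simp: g_def)
  have summ: "summable (\<lambda>i. g i s)" for s
    by (rule summable_comparison_test'[OF sm, of 0]) (use g in auto)
  have cg: "continuous_on UNIV (g i)" for i
  proof -
    have "continuous_on UNIV (\<lambda>s::nat \<Rightarrow> bool. s i)"
      by simp
    moreover have "continuous_on UNIV (of_bool :: bool \<Rightarrow> real)"
      by (simp add: continuous_on_open_vimage open_discrete)
    ultimately have "continuous_on UNIV (\<lambda>s::nat \<Rightarrow> bool. of_bool (s i) :: real)"
      using continuous_on_compose2[of UNIV of_bool UNIV "\<lambda>s::nat \<Rightarrow> bool. s i"] by auto
    then show ?thesis
      unfolding g_def by (intro continuous_intros)
  qed
  have "uniform_limit UNIV (\<lambda>n s. \<Sum>i<n. g i s) e sequentially"
    unfolding e_def by (rule Weierstrass_m_test[OF _ sm]) (use g in auto)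
  then show "continuous_on UNIV e"
    by (rule uniform_limit_theorem[rotated]) (auto intro!: always_eventually continuous_on_sum cg)
  have less: "e t < e s" if n: "s n" "\<not> t n" "\<And>i. i < n \<Longrightarrow> s i = t i" for s t n
  proof -
    have "e t = (\<Sum>i. g (i + Suc n) t) + (\<Sum>i<Suc n. g i t)"
      unfolding e_def by (rule suminf_split_initial_segment[OF summ])
    also have "(\<Sum>i. g (i + Suc n) t) \<le> (\<Sum>i. (1/3) ^ Suc n * (1/3) ^ i)"
    proof (rule suminf_le)
      show "g (i + Suc n) t \<le> (1/3) ^ Suc n * (1/3) ^ i" for i
        using g(2)[of "i + Suc n" t] by (simp add: power_add mult_ac)
      show "summable (\<lambda>i. g (i + Suc n) t)"
        using summ by (rule summable_ignore_initial_segment)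
      show "summable (\<lambda>i. (1/3 :: real) ^ Suc n * (1/3) ^ i)"
        using sm by (rule summable_mult)
    qed
    also have "\<dots> = (1/3) ^ Suc n * (3/2)"
      by (subst suminf_mult[OF sm]) (simp add: suminf_geometric)
    also have "(\<Sum>i<Suc n. g i t) = (\<Sum>i<n. g i s)"
      using n by (simp add: g_def)
    also have "(1/3) ^ Suc n * (3/2) + (\<Sum>i<n. g i s) < (\<Sum>i<Suc n. g i s)"
      using n by (simp add: g_def)
    also have "\<dots> \<le> e s"
      unfolding e_def using g by (intro sum_le_suminf summ) auto
    finally show ?thesis
      by simp
  qed
  show "inj e"
  proof (rule injI, rule ccontr)
    fix s t assume eq: "e s = e t" and "s \<noteq> t"
    then have ex: "\<exists>n. s n \<noteq> t n"
      by auto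
    define n where "n = (LEAST n. s n \<noteq> t n)"
    have n: "s n \<noteq> t n"
      unfolding n_def by (rule LeastI_ex[OF ex])
    have "s i = t i" if "i < n" for i
      using not_less_Least[OF that[unfolded n_def]] by simp
    then have "e t < e s \<or> e s < e t"
      using less[of s n t] less[of t n s] n by metis
    then show False
      using eq by simp
  qed
qed

text \<open>
  A point \<open>h\<close> is coded by a binary sequence: a digit 1 at position \<open>i\<close> asserts that \<open>h\<close> lies in the
  closure of the \<open>i\<close>-th basic open set, a digit 0 that it lies outside that basic open set. Both
  conditions are closed, so the graph of the decoding map is compact.
\<close>

lemma compact_imp_continuous_image_of_reals:
  fixes H :: "'a::second_countable_topology set"
  assumes haus: "Hausdorff_space (euclidean :: 'a topology)" and H: "compact H"
  obtains C :: "real set" and \<phi> where "compact C" "continuous_on C \<phi>" "\<phi> ` C = H"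
proof -
  obtain B :: "nat \<Rightarrow> 'a set" where B: "\<And>i. open (B i)"
      "\<And>S x. open S \<Longrightarrow> x \<in> S \<Longrightarrow> \<exists>i. x \<in> B i \<and> B i \<subseteq> S"
    by (rule countable_base_sequence) blast
  obtain e :: "(nat \<Rightarrow> bool) \<Rightarrow> real" where e: "continuous_on UNIV e" "inj e"
    by (rule Cantor_space_embedding)
  have "compact (UNIV :: bool set)"
    by (rule finite_imp_compact) simp
  then have "compact_space (euclidean :: (nat \<Rightarrow> bool) topology)"
    unfolding euclidean_product_topology[symmetric] compact_space_product_topology
    by (simp add: compact_space_def)
  then have cmp: "compact (UNIV :: (nat \<Rightarrow> bool) set)"
    by (simp add: compact_space_def)
  have closed_digit: "closed {s::nat \<Rightarrow> bool. s i \<in> A}" for i A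
    using closed_vimage[of A "\<lambda>s::nat \<Rightarrow> bool. s i"] by (simp add: vimage_def finite_imp_closed)
  \<comment> \<open>Through the injective \<open>e\<close>, prescribing one digit becomes a closed
    condition on real numbers.\<close>
  define D where "D i b = e ` {s. s i = b}" for i b
  have D: "closed (D i b)" for i b
  proof -
    have "compact {s::nat \<Rightarrow> bool. s i = b}"
      using compact_Int_closed[OF cmp closed_digit[of i "{b}"]] by simp
    then show ?thesis
      unfolding D_def using e(1)
      by (meson compact_continuous_image compact_imp_closed continuous_on_subset top_greatest)
  qed
  have D_e: "e s \<in> D i b \<longleftrightarrow> s i = b" for s i b
    using e(2) by (auto simp: D_def inj_def)
  define \<Gamma> where "\<Gamma> = (range e \<times> H) \<inter>
    (\<Inter>i. D i True \<times> closure (B i) \<union> D i False \<times> (- B i))"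
  have \<Gamma>: "compact \<Gamma>"
    unfolding \<Gamma>_def
    using D B(1) H cmp e(1)
    by (intro compact_Int_closed compact_Times compact_continuous_image closed_INT ballI
        closed_Un closed_Times) auto
  have \<Gamma>_e: "(e s, h) \<in> \<Gamma> \<longleftrightarrow> h \<in> H \<and> (\<forall>i. if s i then h \<in> closure (B i) else h \<notin> B i)" for s h
    by (auto simp: \<Gamma>_def D_e)
  \<comment> \<open>Separate \<open>h\<close> from \<open>k\<close> and shrink to a basic set
    \<open>B i\<close> around \<open>h\<close>. Digit \<open>i\<close> of the code must be 1, as 0
    would exclude \<open>h\<close>; but \<open>k\<close> lies outside
    \<open>closure (B i)\<close>.\<close>
  have unique: "h = k" if t: "(t, h) \<in> \<Gamma>" "(t, k) \<in> \<Gamma>" for t h k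
  proof (rule ccontr)
    assume "h \<noteq> k"
    then obtain U V where UV: "open U" "open V" "h \<in> U" "k \<in> V" "disjnt U V"
      using haus[unfolded Hausdorff_space_def, rule_format, of h k] by (auto simp: open_openin[symmetric])
    obtain i where i: "h \<in> B i" "B i \<subseteq> U"
      using B(2) UV by blast
    have "B i \<inter> V = {}"
      using i UV by (auto simp: disjnt_def)
    then have "k \<notin> closure (B i)"
      using UV by (metis disjoint_iff open_Int_closure_eq_empty Int_commute)
    moreover obtain s where "t = e s"
      using t(1) unfolding \<Gamma>_def by blast
    ultimately show False
      using t i by (auto simp: \<Gamma>_e split: if_splits)
  qed
  define C where "C = fst ` \<Gamma>"
  define \<phi> where "\<phi> t = (THE h. (t, h) \<in> \<Gamma>)" for t
  have \<phi>: "\<phi> t = h" if "(t, h) \<in> \<Gamma>" for t h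
    unfolding \<phi>_def using that unique by blast
  have compact_fst: "compact (fst ` \<Delta>)" if "compact \<Delta>" for \<Delta> :: "(real \<times> 'a) set"
    using that by (intro compact_continuous_image continuous_intros)
  have "compact C"
    unfolding C_def using \<Gamma> by (rule compact_fst)
  \<comment> \<open>A closed-graph argument: the preimage of a closed set is the projection of a
    compact part of \<open>\<Gamma>\<close>.\<close>
  moreover have "continuous_on C \<phi>"
    unfolding continuous_on_closed_vimage[OF compact_imp_closed[OF \<open>compact C\<close>]]
  proof (intro allI impI)
    fix F :: "'a set" assume "closed F"
    then have "compact (fst ` (\<Gamma> \<inter> (UNIV \<times> F)))"
      using \<Gamma> by (intro compact_fst compact_Int_closed closed_Times) auto
    moreover have "\<phi> -` F \<inter> C = fst ` (\<Gamma> \<inter> (UNIV \<times> F))"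
      using \<phi> by (force simp: C_def)
    ultimately show "closed (\<phi> -` F \<inter> C)"
      by (simp add: compact_imp_closed)
  qed
  moreover have "\<phi> ` C = H"
  proof
    show "\<phi> ` C \<subseteq> H"
      using \<phi> by (auto simp: C_def) (auto simp: \<Gamma>_def)
    show "H \<subseteq> \<phi> ` C"
    proof
      fix h assume "h \<in> H"
      then have "(e (\<lambda>i. h \<in> B i), h) \<in> \<Gamma>"
        using closure_subset by (auto simp: \<Gamma>_e)
      then show "h \<in> \<phi> ` C"
        using \<phi> by (force simp: C_def)
    qed
  qed
  ultimately show ?thesis
    by (rule that)
qed

text \<open>
  Helly's selection theorem, available on the real line, is transferred to \<open>H\<close> along a continuous
  surjection from a compact set of reals.
\<close>

lemma compact_support_weakly_convergent_subsequence:
  fixes H :: "'a::second_countable_topology set" and q :: "nat \<Rightarrow> 'i pmf" and y :: "'i \<Rightarrow> 'a"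
  assumes haus: "Hausdorff_space (euclidean :: 'a topology)" and H: "compact H" "range y \<subseteq> H"
  obtains r :: "nat \<Rightarrow> nat" and \<nu> :: "'a measure"
  where "strict_mono r" "prob_space \<nu>" "sets \<nu> = sets borel" "emeasure \<nu> H = 1"
    "\<And>f::'a \<Rightarrow> real. continuous_on UNIV f \<Longrightarrow> bounded (range f) \<Longrightarrow>
       (\<lambda>n. measure_pmf.expectation (q (r n)) (\<lambda>i. f (y i))) \<longlonglongrightarrow> integral\<^sup>L \<nu> f"
proof -
  obtain C :: "real set" and \<phi> :: "real \<Rightarrow> 'a"
    where C: "compact C" and \<phi>: "continuous_on C \<phi>" "\<phi> ` C = H"
    using compact_imp_continuous_image_of_reals[OF haus H(1)] by blast
  have closed_C: "closed C"
    using C by (rule compact_imp_closed)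
  then have [measurable]: "C \<in> sets borel"
    by simp
  have "\<exists>t. t \<in> C \<and> \<phi> t = y i" for i
    proof -
      have "y i \<in> \<phi> ` C"
        using \<phi>(2) H(2) by auto
      then show ?thesis
        by auto
    qed
  then obtain t where t: "\<And>i. t i \<in> C" "\<And>i. \<phi> (t i) = y i"
    by metis
  then have "C \<noteq> {}"
    by blast
  obtain b where b: "\<And>s. s \<in> C \<Longrightarrow> \<bar>s\<bar> \<le> b"
    using compact_imp_bounded[OF C] by (auto simp: bounded_iff)
  define \<mu> where "\<mu> n = distr (measure_pmf (q n)) borel t" for n
  have tight: "tight \<mu>"
    unfolding tight_def
  proof (intro conjI allI impI)
    show "real_distribution (\<mu> n)" for n
      unfolding \<mu>_def by (rule prob_space.real_distribution_distr[OF measure_pmf.prob_space_axioms]) simp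
    fix \<epsilon> :: real assume "\<epsilon> > 0"
    \<comment> \<open>The interval is open on the left, so it starts at \<open>- b - 1\<close> in
      order to contain \<open>- b\<close>.\<close>
    have "t -` {- b - 1<..b} = UNIV"
    proof -
      have "- b - 1 < t i \<and> t i \<le> b" for i
        using b[OF t(1)[of i]] by linarith
      then show ?thesis
        by auto
    qed
    then have "measure (\<mu> n) {- b - 1<..b} = 1" for n
      by (simp add: \<mu>_def measure_distr)
    moreover have "- b - 1 < b"
      using b[OF t(1)[of undefined]] by linarith
    ultimately show "\<exists>a b. a < b \<and> (\<forall>n. 1 - \<epsilon> < measure (\<mu> n) {a<..b})"
      using \<open>\<epsilon> > 0\<close> by (intro exI[of _ "- b - 1"] exI[of _ b]) simp
  qed
  obtain r :: "nat \<Rightarrow> nat" and L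
    where r: "strict_mono r" and L: "real_distribution L" "weak_conv_m (\<mu> \<circ> r) L"
    using tight_imp_convergent_subsubsequence[OF tight strict_mono_id] by auto
  interpret L: real_distribution L by fact
  have conv: "(\<lambda>n. measure_pmf.expectation (q (r n)) (\<lambda>i. g (t i))) \<longlonglongrightarrow> integral\<^sup>L L g"
    if g: "continuous_on UNIV g" "\<And>s. norm (g s) \<le> B" for g :: "real \<Rightarrow> real" and B
  proof -
    have [measurable]: "g \<in> borel_measurable borel"
      using g(1) by (rule borel_measurable_continuous_onI)
    have "(\<lambda>n. integral\<^sup>L ((\<mu> \<circ> r) n) g) \<longlonglongrightarrow> integral\<^sup>L L g"
    proof (rule weak_conv_imp_integral_bdd_continuous_conv)
      show "real_distribution ((\<mu> \<circ> r) n)" for n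
        unfolding \<mu>_def comp_def by (rule prob_space.real_distribution_distr[OF measure_pmf.prob_space_axioms]) simp
      show "isCont g s" for s
        using g(1) by (simp add: continuous_on_eq_continuous_at)
    qed (use L g in \<open>auto simp: comp_def\<close>)
    then show ?thesis
      by (simp add: \<mu>_def integral_distr)
  qed
  have AE_C: "AE s in L. s \<in> C"
  proof -
    \<comment> \<open>The truncated distance to \<open>C\<close> vanishes at every
      \<open>t i\<close>, so its integral under the limit \<open>L\<close> is 0 and \<open>L\<close>
      is carried by \<open>C\<close>.\<close>
    define g where "g s = min 1 (infdist s C)" for s
    have g: "continuous_on UNIV g" "\<And>s. 0 \<le> g s" "\<And>s. g s \<le> 1"
      unfolding g_def by (auto intro!: continuous_intros infdist_nonneg)
    then have [measurable]: "g \<in> borel_measurable borel"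
      by (intro borel_measurable_continuous_onI)
    have "(\<lambda>n. measure_pmf.expectation (q (r n)) (\<lambda>i. g (t i))) \<longlonglongrightarrow> integral\<^sup>L L g"
      using g by (intro conv[of g 1]) auto
    moreover have "g (t i) = 0" for i
      using t(1) by (simp add: g_def)
    ultimately have "integral\<^sup>L L g = 0"
      by (simp add: LIMSEQ_const_iff)
    moreover have "integrable L g"
      using g by (intro L.integrable_const_bound[of _ 1]) auto
    ultimately have ev: "AE s in L. g s = 0"
      using g(2) by (simp add: integral_nonneg_eq_0_iff_AE)
    have "s \<in> C" if "g s = 0" for s
      using that in_closed_iff_infdist_zero[OF closed_C \<open>C \<noteq> {}\<close>] by (simp add: g_def min_def split: if_splits)
    with ev show ?thesis
      by (auto elim: eventually_mono)
  qed
  \<comment> \<open>A total Borel extension of \<open>\<phi>\<close>. The value off \<open>C\<close>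
    is some point of \<open>H\<close>, so that the image measure is carried by
    \<open>H\<close>.\<close>
  define \<psi> where "\<psi> s = (if s \<in> C then \<phi> s else y undefined)" for s
  have \<psi> [measurable]: "\<psi> \<in> borel_measurable borel"
    unfolding \<psi>_def using \<phi>(1) by (intro borel_measurable_continuous_on_if) auto
  define \<nu> where "\<nu> = distr L borel \<psi>"
  have "\<psi> s \<in> H" for s
    using \<phi>(2) H(2) by (auto simp: \<psi>_def)
  moreover have "closed H"
    unfolding closed_closedin using haus H(1) by (intro compactin_imp_closedin) simp_all
  ultimately have "emeasure \<nu> H = 1"
    using L.emeasure_space_1 by (simp add: \<nu>_def emeasure_distr vimage_def)
  moreover have "(\<lambda>n. measure_pmf.expectation (q (r n)) (\<lambda>i. f (y i))) \<longlonglongrightarrow> integral\<^sup>L \<nu> f"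
    if f: "continuous_on UNIV f" "bounded (range f)" for f :: "'a \<Rightarrow> real"
  proof -
    obtain B where B: "\<And>a. norm (f a) \<le> B"
      using f(2) by (auto simp: bounded_iff)
    then have "0 \<le> B"
      using norm_ge_zero order_trans by blast
    have [measurable]: "f \<in> borel_measurable borel"
      using f(1) by (rule borel_measurable_continuous_onI)
    \<comment> \<open>Weak convergence to \<open>L\<close> is tested by functions on the whole line;
      Tietze extends the pulled-back function with the same bound.\<close>
    have "continuous_on C (f \<circ> \<phi>)"
      using \<phi>(1) f(1) by (meson continuous_on_compose continuous_on_subset top_greatest)
    then obtain g where g: "continuous_on UNIV g" "\<And>s. s \<in> C \<Longrightarrow> g s = (f \<circ> \<phi>) s" "\<And>s. norm (g s) \<le> B"
      using Tietze[of C "f \<circ> \<phi>" UNIV B] closed_C B \<open>0 \<le> B\<close> by auto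
    have [measurable]: "g \<in> borel_measurable borel"
      using g(1) by (rule borel_measurable_continuous_onI)
    have "integral\<^sup>L \<nu> f = (\<integral>s. f (\<psi> s) \<partial>L)"
      by (simp add: \<nu>_def integral_distr)
    also have "\<dots> = integral\<^sup>L L g"
    proof (rule integral_cong_AE)
      show "AE s in L. f (\<psi> s) = g s"
        using AE_C by eventually_elim (simp add: \<psi>_def g(2))
    qed measurable
    finally show ?thesis
      using conv[OF g(1,3)] g(2) t by simp
  qed
  moreover have "prob_space \<nu>"
    unfolding \<nu>_def by (rule L.prob_space_distr) simp
  ultimately show ?thesis
    using that[of r \<nu>] r by (simp add: \<nu>_def)
qed

section \<open>Binomial distributions\<close>

lemma sums_expectation_nat_pmf:
  fixes q :: "nat pmf" and f :: "nat \<Rightarrow> 'b::{banach, second_countable_topology}"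
  assumes "bounded (range f)"
  shows "(\<lambda>k. pmf q k *\<^sub>R f k) sums measure_pmf.expectation q f"
proof -
  obtain B where B: "\<And>k. norm (f k) \<le> B"
    using assms by (auto simp: bounded_iff)
  have "integrable (measure_pmf q) f"
    by (rule measure_pmf.integrable_const_bound[of _ B]) (auto simp: B)
  then have "integrable (count_space UNIV) (\<lambda>k. pmf q k *\<^sub>R f k)"
    by (simp add: measure_pmf_eq_density integrable_density)
  then have "(\<lambda>k. pmf q k *\<^sub>R f k) sums (\<integral>k. pmf q k *\<^sub>R f k \<partial>count_space UNIV)"
    by (rule sums_integral_count_space_nat)
  then show ?thesis
    by (simp add: measure_pmf_eq_density integral_density)
qed

text \<open>Conditioning on one trial. It drives the induction over the row sums and the comparison
  of \<open>N\<close> with \<open>N + 1\<close>.\<close>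

lemma expectation_binomial_pmf_Suc:
  fixes f :: "nat \<Rightarrow> 'b::{banach, second_countable_topology}"
  assumes p: "p \<in> {0..1}"
  shows "measure_pmf.expectation (binomial_pmf (Suc n) p) f =
    p *\<^sub>R measure_pmf.expectation (binomial_pmf n p) (\<lambda>k. f (Suc k)) +
    (1 - p) *\<^sub>R measure_pmf.expectation (binomial_pmf n p) f"
proof -
  have fin: "finite (set_pmf (binomial_pmf n p))"
    using p by auto
  have inner: "measure_pmf.expectation
      (binomial_pmf n p \<bind> (\<lambda>k. return_pmf ((if b then 1 else 0) + k))) f =
      measure_pmf.expectation (binomial_pmf n p) (\<lambda>k. f ((if b then 1 else 0) + k))" for b
    unfolding map_pmf_def[symmetric] by (simp add: integral_map_pmf)
  have "measure_pmf.expectation (binomial_pmf (Suc n) p) f =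
    (\<Sum>b\<in>UNIV. pmf (bernoulli_pmf p) b *\<^sub>R measure_pmf.expectation
      (binomial_pmf n p \<bind> (\<lambda>k. return_pmf ((if b then 1 else 0) + k))) f)"
    unfolding binomial_pmf_Suc[OF p] using fin by (intro pmf_expectation_bind) auto
  also have "\<dots> = p *\<^sub>R measure_pmf.expectation (binomial_pmf n p) (\<lambda>k. f (Suc k)) +
    (1 - p) *\<^sub>R measure_pmf.expectation (binomial_pmf n p) f"
    unfolding inner using p by (simp add: UNIV_bool add.commute)
  finally show ?thesis .
qed

text \<open>For \<open>p\<close> between 0 and \<open>1/2\<close>, \<open>ln (1 - p)\<close> lies
  between \<open>- p - 2 * p\<^sup>2\<close> and \<open>- p\<close>. After multiplication by
  \<open>K n\<close> the quadratic term still tends to 0, because \<open>K n * p n\<close> converges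
  and \<open>p n\<close> tends to 0.\<close>

lemma tendsto_power_exp_neg:
  fixes p :: "nat \<Rightarrow> real" and K :: "nat \<Rightarrow> nat"
  assumes p: "p \<longlonglongrightarrow> 0" "eventually (\<lambda>n. 0 \<le> p n) sequentially"
    and Kp: "(\<lambda>n. real (K n) * p n) \<longlonglongrightarrow> c"
  shows "(\<lambda>n. (1 - p n) ^ K n) \<longlonglongrightarrow> exp (- c)"
proof (rule tendsto_sandwich)
  have *: "eventually (\<lambda>n. 0 \<le> p n \<and> p n \<le> 1/2) sequentially"
    using p(2) order_tendstoD(2)[OF p(1), of "1/2"] by (auto elim: eventually_elim2)
  have eq: "(1 - p) ^ k = exp (real k * ln (1 - p))" if "p \<le> 1/2" for p :: real and k
    using that by (simp add: exp_of_nat_mult)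
  show "eventually (\<lambda>n. exp (- (real (K n) * p n) - 2 * (real (K n) * p n) * p n) \<le> (1 - p n) ^ K n) sequentially"
    using *
  proof eventually_elim
    case (elim n)
    then have "- p n - 2 * (p n)\<^sup>2 \<le> ln (1 - p n)"
      by (intro ln_one_minus_pos_lower_bound) auto
    then have "real (K n) * (- p n - 2 * (p n)\<^sup>2) \<le> real (K n) * ln (1 - p n)"
      by (intro mult_left_mono) auto
    then show ?case
      using elim by (simp add: eq algebra_simps power2_eq_square)
  qed
  show "eventually (\<lambda>n. (1 - p n) ^ K n \<le> exp (- (real (K n) * p n))) sequentially"
    using *
  proof eventually_elim
    case (elim n)
    then have "ln (1 - p n) \<le> - p n"
      using ln_le_minus_one[of "1 - p n"] by simp
    then have "real (K n) * ln (1 - p n) \<le> real (K n) * (- p n)"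
      by (intro mult_left_mono) auto
    then show ?case
      using elim by (simp add: eq)
  qed
  have "(\<lambda>n. exp (- (real (K n) * p n) - 2 * (real (K n) * p n) * p n)) \<longlonglongrightarrow> exp (- c - 2 * c * 0)"
    by (intro tendsto_intros Kp p)
  then show "(\<lambda>n. exp (- (real (K n) * p n) - 2 * (real (K n) * p n) * p n)) \<longlonglongrightarrow> exp (- c)"
    by simp
  show "(\<lambda>n. exp (- (real (K n) * p n))) \<longlonglongrightarrow> exp (- c)"
    by (intro tendsto_intros Kp)
qed

text \<open>\<open>(K n choose k) * p n ^ k\<close> is the product of the \<open>k\<close> factors
  \<open>K n * p n - i * p n\<close>, divided by \<open>fact k\<close>; each factor tends to
  \<open>c\<close>.\<close>

lemma tendsto_pmf_binomial_poisson:
  fixes p :: "nat \<Rightarrow> real" and K :: "nat \<Rightarrow> nat"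
  assumes p: "p \<longlonglongrightarrow> 0" "eventually (\<lambda>n. 0 \<le> p n) sequentially"
    and K: "filterlim K at_top sequentially" and Kp: "(\<lambda>n. real (K n) * p n) \<longlonglongrightarrow> c"
  shows "(\<lambda>n. real (K n choose k) * p n ^ k * (1 - p n) ^ (K n - k)) \<longlonglongrightarrow> c ^ k / fact k * exp (- c)"
proof (rule Lim_transform_eventually)
  have "(\<lambda>n. (\<Prod>i=0..<k. real (K n) * p n - real i * p n) / fact k * ((1 - p n) ^ K n / (1 - p n) ^ k))
      \<longlonglongrightarrow> (\<Prod>i=0..<k. c - real i * 0) / fact k * (exp (- c) / (1 - 0) ^ k)"
    by (intro tendsto_intros p Kp tendsto_power_exp_neg) auto
  then show "(\<lambda>n. (\<Prod>i=0..<k. real (K n) * p n - real i * p n) / fact k * ((1 - p n) ^ K n / (1 - p n) ^ k))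
      \<longlonglongrightarrow> c ^ k / fact k * exp (- c)"
    by simp
  have "eventually (\<lambda>n. p n < 1) sequentially" "eventually (\<lambda>n. k \<le> K n) sequentially"
    using order_tendstoD(2)[OF p(1), of 1] K by (auto simp: filterlim_at_top)
  then show "eventually (\<lambda>n. (\<Prod>i=0..<k. real (K n) * p n - real i * p n) / fact k *
      ((1 - p n) ^ K n / (1 - p n) ^ k) =
      real (K n choose k) * p n ^ k * (1 - p n) ^ (K n - k)) sequentially"
  proof eventually_elim
    case (elim n)
    have "real (K n choose k) * p n ^ k = (\<Prod>i=0..<k. real (K n) * p n - real i * p n) / fact k"
      by (simp add: binomial_gbinomial gbinomial_prod_rev left_diff_distrib[symmetric] prod.distrib)
    then show ?case
      using elim by (simp add: power_diff)
  qed
qed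

text \<open>Tannery's theorem, with an exponential series as majorant, lifts the convergence of the
  single weights to all bounded sequences.\<close>

lemma tendsto_expectation_binomial_poisson:
  fixes p :: "nat \<Rightarrow> real" and K :: "nat \<Rightarrow> nat"
    and f :: "nat \<Rightarrow> 'b::{real_normed_algebra, banach, second_countable_topology}"
  assumes p: "p \<longlonglongrightarrow> 0" "eventually (\<lambda>n. 0 \<le> p n) sequentially"
    and K: "filterlim K at_top sequentially" and Kp: "(\<lambda>n. real (K n) * p n) \<longlonglongrightarrow> c"
    and f: "bounded (range f)"
  shows "(\<lambda>n. measure_pmf.expectation (binomial_pmf (K n) (p n)) f)
    \<longlonglongrightarrow> (\<Sum>k. (c ^ k / fact k * exp (- c)) *\<^sub>R f k)"
proof -
  obtain B where B: "\<And>k. norm (f k) \<le> B"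
    using f by (auto simp: bounded_iff)
  have "0 \<le> B"
    using norm_ge_zero B order_trans by blast
  \<comment> \<open>Any number above the limit \<open>c\<close> eventually bounds
    \<open>K n * p n\<close>.\<close>
  define D where "D = c + 1"
  define a where "a k n = (real (K n choose k) * p n ^ k * (1 - p n) ^ (K n - k)) *\<^sub>R f k" for k n
  have ev: "eventually (\<lambda>n. 0 \<le> p n \<and> p n \<le> 1 \<and> real (K n) * p n \<le> D) sequentially"
  proof -
    have "eventually (\<lambda>n. p n < 1) sequentially" "eventually (\<lambda>n. real (K n) * p n < D) sequentially"
      by (rule order_tendstoD(2)[OF p(1)] order_tendstoD(2)[OF Kp], simp add: D_def)+
    with p(2) show ?thesis
      by eventually_elim auto
  qed
  have bound: "eventually (\<lambda>n. \<forall>k. norm (a k n) \<le> D ^ k / fact k * B) sequentially"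
    using ev
  proof eventually_elim
    case (elim n)
    show ?case
    proof
      fix k
      have "real (K n choose k) * fact k \<le> real (K n) ^ k"
        using binomial_fact_pow[of "K n" k] by (metis of_nat_fact of_nat_le_iff of_nat_mult of_nat_power)
      then have "real (K n choose k) \<le> real (K n) ^ k / fact k"
        by (simp add: field_simps)
      then have "real (K n choose k) * p n ^ k \<le> real (K n) ^ k / fact k * p n ^ k"
        using elim by (intro mult_right_mono) auto
      also have "\<dots> = (real (K n) * p n) ^ k / fact k"
        by (simp add: power_mult_distrib)
      also have "\<dots> \<le> D ^ k / fact k"
        using elim by (intro divide_right_mono power_mono) auto
      finally have le: "real (K n choose k) * p n ^ k \<le> D ^ k / fact k" .
      have "real (K n choose k) * p n ^ k * (1 - p n) ^ (K n - k) \<le> D ^ k / fact k * 1"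
        using elim le by (intro mult_mono power_le_one) (auto intro: order_trans[OF _ le])
      then have "real (K n choose k) * p n ^ k * (1 - p n) ^ (K n - k) * norm (f k) \<le> D ^ k / fact k * B"
        using elim B \<open>0 \<le> B\<close> by (intro mult_mono) (auto intro: order_trans[OF _ le])
      then show "norm (a k n) \<le> D ^ k / fact k * B"
        using elim by (simp add: a_def)
    qed
  qed
  have "summable (\<lambda>k. D ^ k / fact k * B)"
    using summable_exp[of D] by (intro summable_mult2) (simp add: field_simps)
  moreover have "eventually (\<lambda>(k, n). norm (a k n) \<le> D ^ k / fact k * B) (at_top \<times>\<^sub>F sequentially)"
    unfolding eventually_prod_filter using bound
    by (intro exI[of _ "\<lambda>_. True"] exI[of _ "\<lambda>n. \<forall>k. norm (a k n) \<le> D ^ k / fact k * B"]) auto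
  moreover have "(\<lambda>n. a k n) \<longlonglongrightarrow> (c ^ k / fact k * exp (- c)) *\<^sub>R f k" for k
    unfolding a_def by (intro tendsto_intros tendsto_pmf_binomial_poisson assms)
  ultimately have lim: "(\<lambda>n. suminf (\<lambda>k. a k n)) \<longlonglongrightarrow> (\<Sum>k. (c ^ k / fact k * exp (- c)) *\<^sub>R f k)"
    using tannerys_theorem[of a "\<lambda>k. (c ^ k / fact k * exp (- c)) *\<^sub>R f k" sequentially "\<lambda>k. D ^ k / fact k * B"]
    by auto
  have "eventually (\<lambda>n. suminf (\<lambda>k. a k n) = measure_pmf.expectation (binomial_pmf (K n) (p n)) f) sequentially"
    using ev
  proof eventually_elim
    case (elim n)
    then show ?case
      using sums_unique[OF sums_expectation_nat_pmf[OF f, of "binomial_pmf (K n) (p n)"]]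
      by (simp add: a_def)
  qed
  then show ?thesis
    using lim by (rule Lim_transform_eventually[rotated])
qed

text \<open>
  The right-hand side of \<open>size_bias\<close> is the size-biased expectation, whose density
  \<open>k / (Suc n * p)\<close> is close to 1 in mean square by Chebyshev's argument.
\<close>

lemma expectation_binomial_pmf_shift:
  fixes f :: "nat \<Rightarrow> real"
  assumes p: "0 < p" "p \<le> 1" and f: "\<And>k. \<bar>f k\<bar> \<le> B"
  shows "(1 - p) * \<bar>measure_pmf.expectation (binomial_pmf n p) (\<lambda>k. f (Suc k)) -
    measure_pmf.expectation (binomial_pmf n p) f\<bar> \<le> B / sqrt (real (Suc n) * p)"
proof -
  define m where "m = Suc n"
  define E where "E = (\<Sum>k\<le>n. Bernstein n k p * f (Suc k))"
  define v where "v = real m * p"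
  define t where "t = 1 / sqrt v"
  have v: "v > 0"
    using p by (simp add: v_def m_def)
  then have t: "t > 0" "t\<^sup>2 = 1 / v"
    by (simp_all add: t_def power_divide)
  have p': "p \<in> {0..1}"
    using p by simp
  have exp_eq: "measure_pmf.expectation (binomial_pmf l p) g = (\<Sum>k\<le>l. Bernstein l k p * g k)"
    for l and g :: "nat \<Rightarrow> real"
    using p by (subst expectation_binomial_pmf'[OF p']) (simp add: Bernstein_def)
  have size_bias: "v * E = (\<Sum>k\<le>m. Bernstein m k p * (real k * f k))"
  proof -
    have step: "Bernstein (Suc n) (Suc k) p * (real (Suc k) * f (Suc k)) = v * (Bernstein n k p * f (Suc k))" for k
    proof -
      have "real (Suc k) * real (Suc n choose Suc k) = real (Suc n) * real (n choose k)"
        using Suc_times_binomial[of k n] by (metis of_nat_mult)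
      moreover have "Bernstein (Suc n) (Suc k) p * (real (Suc k) * f (Suc k)) =
          (real (Suc k) * real (Suc n choose Suc k)) * (p * p ^ k * (1 - p) ^ (n - k) * f (Suc k))"
        by (simp add: Bernstein_def mult_ac del: of_nat_Suc binomial_Suc_Suc)
      ultimately show ?thesis
        by (simp add: Bernstein_def v_def m_def mult_ac del: of_nat_Suc)
    qed
    show ?thesis
      unfolding m_def E_def sum.atMost_Suc_shift step sum_distrib_left by simp
  qed
  \<comment> \<open>The normalized variance, with exact value \<open>(1 - p) / v\<close>, computed
    from the first two factorial moments.\<close>
  have moment2: "(\<Sum>k\<le>m. Bernstein m k p * (1 - real k / v)\<^sup>2) \<le> 1 / v"
  proof -
    have "Bernstein m k p * (1 - real k / v)\<^sup>2 =
      Bernstein m k p - (2 / v) * (real k * Bernstein m k p) +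
      (1 / v\<^sup>2) * (real k * (real k - 1) * Bernstein m k p) + (1 / v\<^sup>2) * (real k * Bernstein m k p)" for k
      using v by (simp add: field_simps power2_eq_square)
    then have "(\<Sum>k\<le>m. Bernstein m k p * (1 - real k / v)\<^sup>2) =
      1 - (2 / v) * (real m * p) + (1 / v\<^sup>2) * (real m * (real m - 1) * p\<^sup>2) + (1 / v\<^sup>2) * (real m * p)"
      by (simp only: sum.distrib sum_subtractf sum_distrib_left[symmetric] sum_Bernstein sum_k_Bernstein sum_kk_Bernstein)
    also have "\<dots> = (1 - p) / v"
    proof -
      have mm: "real m * (real m - 1) * p\<^sup>2 = v\<^sup>2 - v * p"
        by (simp add: v_def power2_eq_square algebra_simps)
      show ?thesis
        unfolding mm v_def[symmetric] using v by (simp add: field_simps power2_eq_square)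
    qed
    also have "\<dots> \<le> 1 / v"
      using v p by (intro divide_right_mono) auto
    finally show ?thesis .
  qed
  \<comment> \<open>Conditioning on one of \<open>m\<close> trials expresses the expectation for
    \<open>m\<close> by those of \<open>f (N + 1)\<close> and \<open>f N\<close> for
    \<open>n\<close> trials. Against \<open>m\<close> trials, \<open>E\<close> becomes a size-biased
    expectation, so the difference is an expectation under a single law.\<close>
  have "(1 - p) * (measure_pmf.expectation (binomial_pmf n p) f - E) =
      measure_pmf.expectation (binomial_pmf m p) f - E"
    unfolding m_def expectation_binomial_pmf_Suc[OF p'] exp_eq[of n "\<lambda>k. f (Suc k)"] E_def
    by (simp add: algebra_simps)
  also have "\<dots> = (\<Sum>k\<le>m. Bernstein m k p * (f k * (1 - real k / v)))"
  proof -
    have "E = (\<Sum>k\<le>m. Bernstein m k p * (real k * f k)) / v"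
      using v size_bias by (simp add: field_simps)
    then show ?thesis
      by (simp add: exp_eq sum_subtractf[symmetric] sum_divide_distrib algebra_simps)
  qed
  finally have "(1 - p) * \<bar>measure_pmf.expectation (binomial_pmf n p) f - E\<bar> =
      \<bar>\<Sum>k\<le>m. Bernstein m k p * (f k * (1 - real k / v))\<bar>"
    using p by (metis abs_mult abs_of_nonneg diff_ge_0_iff_ge)
  also have "\<dots> \<le> (\<Sum>k\<le>m. \<bar>Bernstein m k p * (f k * (1 - real k / v))\<bar>)"
    by (rule sum_abs)
  also have "\<dots> \<le> (\<Sum>k\<le>m. B * (t / 2 * Bernstein m k p + 1 / (2 * t) * (Bernstein m k p * (1 - real k / v)\<^sup>2)))"
  proof (rule sum_mono)
    fix k
    define d where "d = 1 - real k / v"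
    \<comment> \<open>A weighted arithmetic-geometric inequality in place of Cauchy-Schwarz. The
      weight \<open>t\<close> balances the two terms: the second moment is at most
      \<open>1 / v = t\<^sup>2\<close>, so after summation each contributes at most
      \<open>B * t / 2\<close>.\<close>
    have "0 \<le> (t - \<bar>d\<bar>)\<^sup>2"
      by simp
    then have "2 * t * \<bar>d\<bar> \<le> t\<^sup>2 + d\<^sup>2"
      by (simp add: power2_diff)
    then have d: "\<bar>d\<bar> \<le> t / 2 + 1 / (2 * t) * d\<^sup>2"
      using t(1) by (simp add: field_simps power2_eq_square)
    have "0 \<le> B"
      using f[of 0] by linarith
    have b: "0 \<le> Bernstein m k p"
      using p by (intro Bernstein_nonneg) auto
    then have "\<bar>Bernstein m k p * (f k * d)\<bar> = Bernstein m k p * (\<bar>f k\<bar> * \<bar>d\<bar>)"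
      by (simp add: abs_mult)
    also have "\<dots> \<le> Bernstein m k p * (B * (t / 2 + 1 / (2 * t) * d\<^sup>2))"
      using b f d \<open>0 \<le> B\<close> by (intro mult_left_mono mult_mono) auto
    finally show "\<bar>Bernstein m k p * (f k * (1 - real k / v))\<bar> \<le>
        B * (t / 2 * Bernstein m k p + 1 / (2 * t) * (Bernstein m k p * (1 - real k / v)\<^sup>2))"
      by (simp add: d_def[symmetric] algebra_simps)
  qed
  also have "\<dots> = B * (t / 2 + 1 / (2 * t) * (\<Sum>k\<le>m. Bernstein m k p * (1 - real k / v)\<^sup>2))"
    by (simp only: sum_distrib_left[symmetric] sum.distrib sum_Bernstein mult_1_right)
  also have "\<dots> \<le> B * (t / 2 + 1 / (2 * t) * (1 / v))"
    using moment2 t(1) f[of 0] by (intro mult_left_mono add_left_mono) auto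
  also have "\<dots> = B / sqrt v"
  proof -
    have "t / 2 + 1 / (2 * t) * t\<^sup>2 = t"
      using t(1) by (simp add: field_simps power2_eq_square)
    then show ?thesis
      unfolding t(2)[symmetric] by (simp add: t_def)
  qed
  finally show ?thesis
    by (simp add: exp_eq E_def v_def m_def abs_minus_commute)
qed

lemma tendsto_expectation_binomial_shift:
  fixes p :: "nat \<Rightarrow> real" and K :: "nat \<Rightarrow> nat" and f :: "nat \<Rightarrow> real"
  assumes p: "p \<longlonglongrightarrow> 0" and Kp: "filterlim (\<lambda>n. real (K n) * p n) at_top sequentially"
    and f: "bounded (range f)"
  shows "(\<lambda>n. measure_pmf.expectation (binomial_pmf (K n) (p n)) (\<lambda>k. f (Suc k)) -
    measure_pmf.expectation (binomial_pmf (K n) (p n)) f) \<longlonglongrightarrow> 0"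
proof -
  obtain B where B: "\<And>k. \<bar>f k\<bar> \<le> B"
    using f by (auto simp: bounded_iff)
  then have "0 \<le> B"
    using abs_ge_zero order_trans by blast
  have sq: "filterlim (\<lambda>n. sqrt (real (K n) * p n)) at_top sequentially"
    by (rule filterlim_compose[OF sqrt_at_top Kp])
  have lim: "(\<lambda>n. 2 * B / sqrt (real (K n) * p n)) \<longlonglongrightarrow> 0"
    by (rule real_tendsto_divide_at_top[OF tendsto_const sq])
  have "eventually (\<lambda>n. 0 < real (K n) * p n) sequentially"
    using Kp by (auto simp: filterlim_at_top_dense)
  \<comment> \<open>Then \<open>1 - p n\<close> exceeds \<open>1/2\<close>, which accounts for the
    factor 2 in the bound.\<close>
  moreover have "eventually (\<lambda>n. p n < 1/2) sequentially"
    by (rule order_tendstoD(2)[OF p]) simp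
  ultimately have "eventually (\<lambda>n. norm (measure_pmf.expectation (binomial_pmf (K n) (p n)) (\<lambda>k. f (Suc k)) -
    measure_pmf.expectation (binomial_pmf (K n) (p n)) f) \<le> 2 * B / sqrt (real (K n) * p n)) sequentially"
  proof eventually_elim
    case (elim n)
    then have pn: "0 < p n" "p n < 1/2" "0 < real (K n) * p n"
      by (auto simp: zero_less_mult_iff)
    let ?d = "\<bar>measure_pmf.expectation (binomial_pmf (K n) (p n)) (\<lambda>k. f (Suc k)) -
      measure_pmf.expectation (binomial_pmf (K n) (p n)) f\<bar>"
    have "1/2 * ?d \<le> (1 - p n) * ?d"
      using pn by (intro mult_right_mono) auto
    also have "\<dots> \<le> B / sqrt (real (Suc (K n)) * p n)"
      using pn by (intro expectation_binomial_pmf_shift B) auto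
    also have "\<dots> \<le> B / sqrt (real (K n) * p n)"
      using pn \<open>0 \<le> B\<close> by (intro divide_left_mono) (auto simp: algebra_simps)
    finally show ?case
      by (simp add: mult.commute)
  qed
  then show ?thesis
    by (rule Lim_null_comparison) (rule lim)
qed

section \<open>Multiples of a point\<close>

primrec multiple :: "nat \<Rightarrow> 'a::monoid_add \<Rightarrow> 'a" where
  "multiple 0 x = 0"
| "multiple (Suc n) x = x + multiple n x"

lemma multiple_add: "multiple (m + n) x = multiple m x + multiple n x"
  by (induction m) (simp_all add: add.assoc)

lemma multiple_mult: "multiple (m * n) x = multiple m (multiple n x)"
  by (induction m) (simp_all add: multiple_add)

lemma multiple_zero [simp]: "multiple n 0 = 0"
  by (induction n) simp_all

text \<open>By induction on the number of summands: the last one is almost surely \<open>x\<close>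
  or \<open>0\<close>, and conditioning on it reproduces the recursion
  \<open>expectation_binomial_pmf_Suc\<close>, with the event translated by \<open>x\<close> in the
  first case.\<close>

lemma (in prob_space) distr_sum_two_point:
  fixes X :: "nat \<Rightarrow> 'a \<Rightarrow> 'g::{topological_ab_group_add, second_countable_topology}"
  assumes sing [measurable]: "{0::'g} \<in> sets borel" "{x} \<in> sets borel" and "x \<noteq> 0"
    and p: "p \<in> {0..1}"
    and X: "\<And>k. k \<in> {1..m} \<Longrightarrow> X k \<in> borel_measurable M"
    and indep: "indep_vars (\<lambda>_. borel) X {1..m}"
    and prob_x: "\<And>k. k \<in> {1..m} \<Longrightarrow> prob {\<omega> \<in> space M. X k \<omega> = x} = p"
    and prob_0: "\<And>k. k \<in> {1..m} \<Longrightarrow> prob {\<omega> \<in> space M. X k \<omega> = 0} = 1 - p"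
  shows "distr M borel (\<lambda>\<omega>. \<Sum>k=1..m. X k \<omega>) =
    distr (measure_pmf (binomial_pmf m p)) borel (\<lambda>k. multiple k x)"
proof -
  have binomial: "measure (distr (measure_pmf (binomial_pmf n p)) borel (\<lambda>k. multiple k x)) A =
      measure_pmf.expectation (binomial_pmf n p) (\<lambda>k. indicator A (multiple k x))"
    if "A \<in> sets borel" for A :: "'g set" and n
  proof -
    have "measure_pmf.expectation (binomial_pmf n p) (\<lambda>k. indicator A (multiple k x) :: real) =
        measure_pmf.expectation (binomial_pmf n p) (indicator ((\<lambda>k. multiple k x) -` A))"
      by (rule arg_cong[where f = "measure_pmf.expectation (binomial_pmf n p)"])
         (simp add: indicator_def fun_eq_iff)
    then show ?thesis
      using that by (simp add: measure_distr)
  qed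
  have "measure (distr M borel (\<lambda>\<omega>. \<Sum>k=1..n. X k \<omega>)) A =
      measure_pmf.expectation (binomial_pmf n p) (\<lambda>k. indicator A (multiple k x))"
    if "n \<le> m" "A \<in> sets borel" for n A
    using that
  \<comment> \<open>\<open>A\<close> varies because the hypothesis is applied to its translate as
    well.\<close>
  proof (induction n arbitrary: A)
    case 0
    then show ?case
      using p by (simp add: binomial_pmf_0 measure_distr prob_space indicator_def measure_def)
  next
    case (Suc n)
    define S where "S \<omega> = (\<Sum>k=1..n. X k \<omega>)" for \<omega>
    define Y where "Y = X (Suc n)"
    have Y: "Y \<in> borel_measurable M" and S: "S \<in> borel_measurable M"
      unfolding Y_def S_def using X Suc.prems by (auto intro!: borel_measurable_sum)
    note [measurable] = Y S Suc.prems(2)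
    have "{1..Suc n} = insert (Suc n) {1..n}"
      by auto
    then have ins: "indep_vars (\<lambda>_. borel) X (insert (Suc n) {1..n})"
      using indep_vars_subset[OF indep] Suc.prems by auto
    \<comment> \<open>The last summand and the sum of the others depend on disjoint blocks of
      indices.\<close>
    have "indep_var
      borel ((\<lambda>f. f (Suc n)) \<circ> (\<lambda>\<omega>. restrict (\<lambda>i. X i \<omega>) {Suc n}))
      borel ((\<lambda>f. \<Sum>i\<in>{1..n}. f i) \<circ> (\<lambda>\<omega>. restrict (\<lambda>i. X i \<omega>) {1..n}))"
      by (intro indep_var_compose[OF indep_var_restrict[OF ins]] borel_measurable_sum) auto
    also have "(\<lambda>f. f (Suc n)) \<circ> (\<lambda>\<omega>. restrict (\<lambda>i. X i \<omega>) {Suc n}) = Y"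
      by (auto simp: Y_def)
    also have "(\<lambda>f. \<Sum>i\<in>{1..n}. f i) \<circ> (\<lambda>\<omega>. restrict (\<lambda>i. X i \<omega>) {1..n}) = S"
      by (auto simp: S_def fun_eq_iff)
    finally have YS: "indep_var borel Y borel S" .
    have trans [measurable]: "(\<lambda>y. x + y) -` A \<in> sets borel"
      using measurable_sets[of "\<lambda>y. x + y" borel borel A] Suc.prems(2) by simp
    have shift: "prob {\<omega> \<in> space M. S \<omega> \<in> B} =
        measure_pmf.expectation (binomial_pmf n p) (\<lambda>k. indicator B (multiple k x))"
      if [measurable]: "B \<in> sets borel" for B
    proof -
      have "{\<omega> \<in> space M. S \<omega> \<in> B} = S -` B \<inter> space M"
        by auto
      then show ?thesis
        using Suc.IH[of B, folded S_def[abs_def]] Suc.prems that measure_distr[OF S that] by simp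
    qed
    have Yp: "prob {\<omega> \<in> space M. Y \<omega> \<in> {x}} = p" "prob {\<omega> \<in> space M. Y \<omega> \<in> {0}} = 1 - p"
      using prob_x[of "Suc n"] prob_0[of "Suc n"] Suc.prems by (auto simp: Y_def)
    have disj: "{\<omega> \<in> space M. Y \<omega> \<in> {x}} \<inter> {\<omega> \<in> space M. Y \<omega> \<in> {0}} = {}"
      using \<open>x \<noteq> 0\<close> by auto
    \<comment> \<open>The two prescribed probabilities add up to 1, which leaves no mass for other
      values.\<close>
    have "prob ({\<omega> \<in> space M. Y \<omega> \<in> {x}} \<union> {\<omega> \<in> space M. Y \<omega> \<in> {0}}) = 1"
      using Yp by (subst finite_measure_Union[OF _ _ disj]) auto
    then have "AE \<omega> in M. \<omega> \<in> {\<omega> \<in> space M. Y \<omega> \<in> {x}} \<union> {\<omega> \<in> space M. Y \<omega> \<in> {0}}"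
      by (subst (asm) prob_eq_1) auto
    then have "AE \<omega> in M. (Y \<omega> + S \<omega> \<in> A) \<longleftrightarrow>
        (Y \<omega> \<in> {x} \<and> S \<omega> \<in> (\<lambda>y. x + y) -` A) \<or> (Y \<omega> \<in> {0} \<and> S \<omega> \<in> A)"
      using \<open>x \<noteq> 0\<close> by (auto elim!: eventually_mono)
    then have "prob {\<omega> \<in> space M. Y \<omega> + S \<omega> \<in> A} =
        prob {\<omega> \<in> space M. (Y \<omega> \<in> {x} \<and> S \<omega> \<in> (\<lambda>y. x + y) -` A) \<or> (Y \<omega> \<in> {0} \<and> S \<omega> \<in> A)}"
      by (intro prob_eq_AE) measurable
    also have "\<dots> = prob ({\<omega> \<in> space M. Y \<omega> \<in> {x} \<and> S \<omega> \<in> (\<lambda>y. x + y) -` A} \<union>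
        {\<omega> \<in> space M. Y \<omega> \<in> {0} \<and> S \<omega> \<in> A})"
      by (rule arg_cong[where f = prob]) auto
    also have "\<dots> = prob {\<omega> \<in> space M. Y \<omega> \<in> {x} \<and> S \<omega> \<in> (\<lambda>y. x + y) -` A} +
        prob {\<omega> \<in> space M. Y \<omega> \<in> {0} \<and> S \<omega> \<in> A}"
      using \<open>x \<noteq> 0\<close> by (intro finite_measure_Union) auto
    also have "\<dots> = p * prob {\<omega> \<in> space M. S \<omega> \<in> (\<lambda>y. x + y) -` A} +
        (1 - p) * prob {\<omega> \<in> space M. S \<omega> \<in> A}"
      using prob_indep_random_variable[OF YS sing(2) trans]
        prob_indep_random_variable[OF YS sing(1) Suc.prems(2)] Yp by simp
    also have "\<dots> = measure_pmf.expectation (binomial_pmf (Suc n) p) (\<lambda>k. indicator A (multiple k x))"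
      unfolding expectation_binomial_pmf_Suc[OF p] shift[OF trans] shift[OF Suc.prems(2)]
      by (simp add: indicator_def)
    also have "{\<omega> \<in> space M. Y \<omega> + S \<omega> \<in> A} = (\<lambda>\<omega>. \<Sum>k=1..Suc n. X k \<omega>) -` A \<inter> space M"
      by (auto simp: S_def Y_def add.commute)
    finally show ?case
      using X Suc.prems by (subst measure_distr) (auto intro!: borel_measurable_sum)
  qed
  then have "measure (distr M borel (\<lambda>\<omega>. \<Sum>k=1..m. X k \<omega>)) A =
      measure (distr (measure_pmf (binomial_pmf m p)) borel (\<lambda>k. multiple k x)) A"
    if "A \<in> sets borel" for A
    using that binomial by simp
  moreover have "prob_space (distr M borel (\<lambda>\<omega>. \<Sum>k=1..m. X k \<omega>))"
    using X by (intro prob_space_distr borel_measurable_sum) auto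
  moreover have "prob_space (distr (measure_pmf (binomial_pmf m p)) borel (\<lambda>k. multiple k x))"
    by (rule measure_pmf.prob_space_distr) simp
  ultimately show ?thesis
    by (intro measure_eqI)
       (auto simp: finite_measure.emeasure_eq_measure prob_space.finite_measure)
qed

section \<open>Compound Poisson measures of point masses\<close>

lemma ex_poisson_pmf:
  fixes c :: real
  assumes "c \<ge> 0"
  obtains q :: "nat pmf" where "\<And>k. pmf q k = c ^ k / fact k * exp (- c)"
proof (cases "c = 0")
  \<comment> \<open>Rate 0 is the point mass at 0; it occurs when \<open>K n * p n\<close> tends to
    0.\<close>
  case True
  then show ?thesis
    using that[of "return_pmf 0"] by (simp add: indicator_def power_0_left)
next
  case False
  then show ?thesis
    using that[of "poisson_pmf c"] assms by simp
qed

lemma group_convolution_point_masses: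
  fixes x y :: "'a::{topological_ab_group_add, second_countable_topology}"
  shows "group_convolution (scale_measure (ennreal a) (return borel x)) (scale_measure (ennreal b) (return borel y)) =
    scale_measure (ennreal a * ennreal b) (return borel (x + y))"
proof (rule measure_eqI)
  let ?\<mu> = "scale_measure (ennreal a) (return borel x)"
  let ?\<nu> = "scale_measure (ennreal b) (return borel y)"
  show "sets (group_convolution ?\<mu> ?\<nu>) =
    sets (scale_measure (ennreal a * ennreal b) (return borel (x + y)))"
    by (simp add: group_convolution_def)
  fix A assume "A \<in> sets (group_convolution ?\<mu> ?\<nu>)"
  then have A [measurable]: "A \<in> sets borel"
    by (simp add: group_convolution_def)
  interpret finite_measure ?\<nu>
    by (rule finite_measureI) (simp add: space_scale_measure ennreal_mult_eq_top_iff)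
  have "sets (?\<mu> \<Otimes>\<^sub>M ?\<nu>) = sets (borel \<Otimes>\<^sub>M borel)"
    by (intro sets_pair_measure_cong) simp_all
  moreover have "(\<lambda>(a, b). a + b :: 'a) \<in> borel_measurable (borel \<Otimes>\<^sub>M borel)"
    by measurable
  ultimately have [measurable]: "(\<lambda>(a, b). a + b) \<in> borel_measurable (?\<mu> \<Otimes>\<^sub>M ?\<nu>)"
    using measurable_cong_sets by blast
  let ?B = "(\<lambda>(a, b). a + b) -` A \<inter> space (?\<mu> \<Otimes>\<^sub>M ?\<nu>)"
  have "emeasure (group_convolution ?\<mu> ?\<nu>) A = emeasure (?\<mu> \<Otimes>\<^sub>M ?\<nu>) ?B"
    unfolding group_convolution_def by (rule emeasure_distr) measurable
  also have "\<dots> = (\<integral>\<^sup>+ u. \<integral>\<^sup>+ v. indicator ?B (u, v) \<partial>?\<nu> \<partial>?\<mu>)"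
    by (rule emeasure_pair_measure) measurable
  also have "\<dots> = (\<integral>\<^sup>+ u. \<integral>\<^sup>+ v. indicator A (u + v) \<partial>?\<nu> \<partial>?\<mu>)"
    by (intro nn_integral_cong) (simp add: indicator_def space_pair_measure space_scale_measure)
  also have "\<dots> = ennreal a * ennreal b * indicator A (x + y)"
    by (simp add: nn_integral_scale_measure nn_integral_return mult.assoc)
  finally show "emeasure (group_convolution ?\<mu> ?\<nu>) A =
      emeasure (scale_measure (ennreal a * ennreal b) (return borel (x + y))) A"
    by simp
qed

lemma convolution_power_point_mass:
  fixes x :: "'a::{topological_ab_group_add, second_countable_topology}"
  assumes "c \<ge> 0"
  shows "convolution_power (scale_measure (ennreal c) (return borel x)) j =
    scale_measure (ennreal (c ^ j)) (return borel (multiple j x))"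
  using assms
  by (induction j) (simp_all add: group_convolution_point_masses ennreal_mult)

text \<open>The \<open>j\<close>-th convolution power is the mass \<open>c ^ j\<close> at
  \<open>multiple j x\<close>, so the defining series is the law of \<open>multiple N x\<close> with
  \<open>N\<close> Poisson. This pulls the limit law back to the naturals, like the row
  sums.\<close>

lemma compound_poisson_point_mass:
  fixes x :: "'a::{topological_ab_group_add, second_countable_topology}"
  assumes c: "c \<ge> 0" and q: "\<And>k. pmf q k = c ^ k / fact k * exp (- c)"
  shows "compound_poisson (scale_measure (ennreal c) (return borel x)) =
    distr (measure_pmf q) borel (\<lambda>k. multiple k x)"
proof (rule measure_eqI)
  let ?P = "compound_poisson (scale_measure (ennreal c) (return borel x))"
  fix A assume "A \<in> sets ?P"
  then have A: "A \<in> sets borel"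
    by simp
  have m: "measure (scale_measure (ennreal c) (return borel x)) UNIV = c"
    using c by (simp add: measure_def)
  have weight: "ennreal (exp (- c)) * (ennreal (c ^ k) * indicator A (multiple k x) / fact k) =
      ennreal (pmf q k) * indicator A (multiple k x)" for k
  proof -
    have "ennreal (pmf q k) = ennreal (exp (- c)) * (ennreal (c ^ k) / ennreal (fact k))"
      using c by (simp add: q divide_ennreal ennreal_mult'[symmetric] mult.commute)
    moreover have "(fact k :: ennreal) = ennreal (fact k)"
      by (metis ennreal_of_nat_eq_real_of_nat of_nat_fact)
    ultimately show ?thesis
      by (simp add: indicator_def)
  qed
  have "emeasure ?P A = (\<Sum>k. ennreal (pmf q k) * indicator A (multiple k x))"
    unfolding emeasure_compound_poisson[OF A] m convolution_power_point_mass[OF c]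
    using A by (simp add: ennreal_suminf_cmult[symmetric] weight)
  also have "\<dots> = (\<integral>\<^sup>+ k. indicator A (multiple k x) \<partial>measure_pmf q)"
    by (simp add: nn_integral_measure_pmf nn_integral_count_space_nat)
  also have "\<dots> = (\<integral>\<^sup>+ k. indicator ((\<lambda>k. multiple k x) -` A) k \<partial>measure_pmf q)"
    by (simp add: indicator_def)
  also have "\<dots> = emeasure (distr (measure_pmf q) borel (\<lambda>k. multiple k x)) A"
    using A by (simp add: emeasure_distr)
  finally show "emeasure ?P A = emeasure (distr (measure_pmf q) borel (\<lambda>k. multiple k x)) A" .
qed simp

text \<open>If \<open>x\<close> has infinite order, its multiples are distinct and \<open>-1\<close>
  serves; if it has finite order \<open>m\<close>, then \<open>m\<close> is at least 2 and a
  primitive \<open>m\<close>-th root of unity serves.\<close>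

lemma ex_cyclic_character:
  fixes x :: "'a::group_add"
  assumes "x \<noteq> 0"
  obtains \<zeta> :: complex where "norm \<zeta> = 1" "\<zeta> \<noteq> 1"
    "\<And>j k. multiple j x = multiple k x \<Longrightarrow> \<zeta> ^ j = \<zeta> ^ k"
proof -
  obtain \<zeta> :: complex where \<zeta>: "norm \<zeta> = 1" "\<zeta> \<noteq> 1" "\<And>d. multiple d x = 0 \<Longrightarrow> \<zeta> ^ d = 1"
  proof (cases "\<exists>m>0. multiple m x = 0")
    case False
    then show ?thesis
      using that[of "-1"] by (metis gr0I norm_minus_cancel norm_one one_neq_neg_one power_0)
  next
    case True
    define m where "m = (LEAST m. m > 0 \<and> multiple m x = 0)"
    have m: "m > 0" "multiple m x = 0"
      using LeastI_ex[OF True] by (simp_all add: m_def)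
    have least: "\<not> (d > 0 \<and> multiple d x = 0)" if "d < m" for d
      using that not_less_Least unfolding m_def by blast
    have "m \<noteq> 1"
      using m assms by auto
    then have "m \<ge> 2"
      using m by simp
    define \<zeta> where "\<zeta> = cis (2 * pi / real m)"
    have "\<zeta> ^ m = 1"
      unfolding \<zeta>_def Complex.DeMoivre using m by simp
    have "\<zeta> \<noteq> 1"
    proof
      assume "\<zeta> = 1"
      then have "cos (2 * pi / real m) = 1"
        by (metis \<zeta>_def cis.simps(1) one_complex.simps(1))
      moreover have "cos (2 * pi / real m) < cos 0"
        using \<open>m \<ge> 2\<close> by (intro cos_monotone_0_pi) (auto simp: field_simps)
      ultimately show False
        by simp
    qed
    moreover have "\<zeta> ^ d = 1" if "multiple d x = 0" for d
    proof -
      have "multiple (d div m * m + d mod m) x = multiple (d mod m) x"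
        using m by (simp only: multiple_add multiple_mult multiple_zero add_0)
      then have "multiple (d mod m) x = 0"
        using that by simp
      then have "d mod m = 0"
        using least[of "d mod m"] m by auto
      then obtain e where "d = m * e"
        by auto
      then show ?thesis
        using \<open>\<zeta> ^ m = 1\<close> by (simp add: power_mult)
    qed
    ultimately show ?thesis
      using that[of \<zeta>] by (simp add: \<zeta>_def)
  qed
  have le: "\<zeta> ^ j = \<zeta> ^ k" if "multiple j x = multiple k x" "j \<le> k" for j k
  proof -
    have "multiple j x + multiple (k - j) x = multiple j x"
      using that by (metis le_add_diff_inverse multiple_add)
    then have "\<zeta> ^ (k - j) = 1"
      by (metis \<zeta>(3) add_left_imp_eq add.right_neutral)
    then show ?thesis
      using that(2) by (metis le_add_diff_inverse mult.right_neutral power_add)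
  qed
  show ?thesis
    using that[OF \<zeta>(1,2)] le by (metis nle_le)
qed

lemma expectation_poisson_power:
  fixes \<zeta> :: complex and q :: "nat pmf"
  assumes \<zeta>: "norm \<zeta> = 1" and q: "\<And>k. pmf q k = c ^ k / fact k * exp (- c)"
  shows "measure_pmf.expectation q (\<lambda>k. \<zeta> ^ k) = exp (of_real c * (\<zeta> - 1))"
proof -
  have "bounded (range (\<lambda>k. \<zeta> ^ k))"
    using \<zeta> by (intro boundedI[of _ 1]) (auto simp: norm_power)
  then have "(\<lambda>k. pmf q k *\<^sub>R \<zeta> ^ k) sums measure_pmf.expectation q (\<lambda>k. \<zeta> ^ k)"
    by (rule sums_expectation_nat_pmf)
  moreover have "(\<lambda>k. of_real (exp (- c)) * ((of_real c * \<zeta>) ^ k /\<^sub>R fact k)) sums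
      (of_real (exp (- c)) * exp (of_real c * \<zeta>))"
    by (intro sums_mult exp_converges)
  moreover have "of_real (exp (- c)) * ((of_real c * \<zeta>) ^ k /\<^sub>R fact k) = pmf q k *\<^sub>R \<zeta> ^ k" for k
    by (simp add: q scaleR_conv_of_real power_mult_distrib field_simps)
  ultimately have "measure_pmf.expectation q (\<lambda>k. \<zeta> ^ k) = of_real (exp (- c)) * exp (of_real c * \<zeta>)"
    using sums_unique2 by auto
  also have "\<dots> = exp (of_real c * (\<zeta> - 1))"
    by (simp add: exp_of_real[symmetric] exp_add[symmetric] algebra_simps)
  finally show ?thesis .
qed

section \<open>Haar measure on the closed subgroup generated by a point\<close>

lemma smallest_closed_subgroup:
  fixes x :: "'a::topological_ab_group_add"
  shows closed_smallest_closed_subgroup: "closed (smallest_closed_subgroup x)"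
    and is_subgroup_smallest_closed_subgroup: "is_subgroup (smallest_closed_subgroup x)"
    and mem_smallest_closed_subgroup: "x \<in> smallest_closed_subgroup x"
proof -
  show "closed (smallest_closed_subgroup x)"
    by (auto simp: smallest_closed_subgroup_def hull_def)
  show "is_subgroup (smallest_closed_subgroup x)"
    by (auto simp: smallest_closed_subgroup_def hull_def is_subgroup_def)
  show "x \<in> smallest_closed_subgroup x"
    unfolding smallest_closed_subgroup_def by (rule hull_inc) simp
qed

lemma multiple_mem_subgroup:
  assumes "is_subgroup H" "x \<in> H"
  shows "multiple n x \<in> H"
  using assms by (induction n) (auto simp: is_subgroup_def)

lemma distr_add_add:
  fixes \<mu> :: "'a::{topological_ab_group_add, second_countable_topology} measure"
  assumes [measurable_cong]: "sets \<mu> = sets borel"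
  shows "distr (distr \<mu> borel ((+) b)) borel ((+) a) = distr \<mu> borel ((+) (a + b))"
proof -
  have "(+) a \<circ> (+) b = (+) (a + b)"
    by (auto simp: add.assoc)
  then show ?thesis
    by (subst distr_distr) auto
qed

text \<open>\<open>is_normalized_haar\<close> speaks of images of sets, weak limits lead to
  push-forwards. The sign changes because a push-forward takes preimages.\<close>

lemma emeasure_distr_add:
  fixes \<mu> :: "'a::{topological_ab_group_add, second_countable_topology} measure"
  assumes sets: "sets \<mu> = sets borel" and A: "A \<in> sets borel"
  shows "emeasure (distr \<mu> borel ((+) (- h))) A = emeasure \<mu> ((+) h ` A)"
proof -
  note [measurable_cong] = sets
  have "(+) (- h) -` A = (+) h ` A"
  proof (intro set_eqI iffI)
    fix y assume "y \<in> (+) (- h) -` A"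
    then have "y = h + (- h + y)" "- h + y \<in> A"
      by simp_all
    then show "y \<in> (+) h ` A"
      by blast
  qed auto
  moreover have "(+) (- h) \<in> measurable \<mu> borel"
    by measurable
  ultimately show ?thesis
    using A sets_eq_imp_space_eq[OF sets] by (simp add: emeasure_distr)
qed

text \<open>Invariance can be tested on bounded continuous \<open>f\<close>, and for each of them
  the integral of \<open>f (h + y)\<close> depends continuously on \<open>h\<close>. This carries
  invariance from the multiples of \<open>x\<close> over to their closure.\<close>

lemma closed_translation_invariance:
  fixes \<mu> :: "'a::{topological_ab_group_add, second_countable_topology} measure"
  assumes \<mu>: "prob_space \<mu>" and sets: "sets \<mu> = sets borel"
  shows "closed {h. distr \<mu> borel ((+) h) = \<mu>}"
proof -
  interpret prob_space \<mu> by fact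
  note [measurable_cong] = sets
  define \<F> where "\<F> = {f::'a \<Rightarrow> real. continuous_on UNIV f \<and> bounded (range f)}"
  have distr: "integral\<^sup>L (distr \<mu> borel ((+) h)) f = (\<integral>y. f (h + y) \<partial>\<mu>)" if "f \<in> \<F>" for f h
  proof (rule integral_distr)
    show "f \<in> borel_measurable borel"
      using that by (auto simp: \<F>_def intro: borel_measurable_continuous_onI)
  qed measurable
  have "closed {h. (\<integral>y. f (h + y) \<partial>\<mu>) = integral\<^sup>L \<mu> f}" if f: "f \<in> \<F>" for f
  proof -
    have f_cont: "continuous_on UNIV f"
      using f by (simp add: \<F>_def)
    then have [measurable]: "f \<in> borel_measurable borel"
      by (rule borel_measurable_continuous_onI)
    obtain B where B: "\<And>y. norm (f y) \<le> B"
      using f by (auto simp: \<F>_def bounded_iff)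
    have "continuous_on UNIV (\<lambda>h. \<integral>y. f (h + y) \<partial>\<mu>)"
      \<comment> \<open>The group is first countable, so sequences suffice and dominated convergence
        applies.\<close>
      unfolding continuous_on_def tendsto_at_iff_sequentially
    proof (intro ballI allI impI)
      fix h and X :: "nat \<Rightarrow> 'a" assume X: "X \<longlonglongrightarrow> h"
      have "(\<lambda>n. \<integral>y. f (X n + y) \<partial>\<mu>) \<longlonglongrightarrow> (\<integral>y. f (h + y) \<partial>\<mu>)"
      proof (rule integral_dominated_convergence[where w = "\<lambda>_. B"])
        have "(\<lambda>n. f (X n + y)) \<longlonglongrightarrow> f (h + y)" for y
          using X by (intro continuous_on_tendsto_compose[OF f_cont] tendsto_intros) auto
        then show "AE y in \<mu>. (\<lambda>n. f (X n + y)) \<longlonglongrightarrow> f (h + y)"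
          by simp
      qed (use B in auto)
      then show "((\<lambda>h. \<integral>y. f (h + y) \<partial>\<mu>) \<circ> X) \<longlonglongrightarrow> (\<integral>y. f (h + y) \<partial>\<mu>)"
        by (simp add: comp_def)
    qed
    then show ?thesis
      by (intro closed_Collect_eq continuous_on_const)
  qed
  then have "closed (\<Inter>f\<in>\<F>. {h. (\<integral>y. f (h + y) \<partial>\<mu>) = integral\<^sup>L \<mu> f})"
    by blast
  moreover have "distr \<mu> borel ((+) h) = \<mu> \<longleftrightarrow> (\<forall>f\<in>\<F>. (\<integral>y. f (h + y) \<partial>\<mu>) = integral\<^sup>L \<mu> f)" for h
  proof
    assume "distr \<mu> borel ((+) h) = \<mu>"
    then show "\<forall>f\<in>\<F>. (\<integral>y. f (h + y) \<partial>\<mu>) = integral\<^sup>L \<mu> f"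
      using distr by metis
  next
    assume eq: "\<forall>f\<in>\<F>. (\<integral>y. f (h + y) \<partial>\<mu>) = integral\<^sup>L \<mu> f"
    show "distr \<mu> borel ((+) h) = \<mu>"
    proof (rule measure_eqI_bounded_continuous)
      show "finite_measure (distr \<mu> borel ((+) h))"
        by (intro prob_space.finite_measure prob_space_distr) measurable
    qed (use eq distr in \<open>auto simp: \<F>_def sets regular_space_topological_group finite_measure_axioms\<close>)
  qed
  ultimately show ?thesis
    by (simp add: INT_iff Collect_ball_eq)
qed

text \<open>The translations that preserve \<open>\<mu>\<close> form a closed subgroup; containing
  \<open>x\<close>, it contains the smallest one.\<close>

lemma is_normalized_haar_translation_invariant:
  fixes \<mu> :: "'a::{topological_ab_group_add, second_countable_topology} measure"
  assumes \<mu>: "prob_space \<mu>" and sets: "sets \<mu> = sets borel"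
    and inv: "distr \<mu> borel ((+) x) = \<mu>"
    and H: "emeasure \<mu> (smallest_closed_subgroup x) = 1"
  shows "is_normalized_haar (smallest_closed_subgroup x) \<mu>"
proof -
  note [measurable_cong] = sets
  define S where "S = {h. distr \<mu> borel ((+) h) = \<mu>}"
  have "is_subgroup S"
    unfolding is_subgroup_def
  proof (intro conjI ballI)
    have zero: "distr \<mu> borel ((+) 0) = \<mu>"
    proof -
      have "(+) 0 = (\<lambda>y::'a. y)"
        by auto
      then show ?thesis
        using distr_id2[of borel \<mu>] sets by metis
    qed
    then show "0 \<in> S"
      by (simp add: S_def)
    show "a + b \<in> S" if "a \<in> S" "b \<in> S" for a b
      using that distr_add_add[OF sets, of b a] by (simp add: S_def)
    show "- a \<in> S" if "a \<in> S" for a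
      using that distr_add_add[OF sets, of a "- a"] zero by (simp add: S_def)
  qed
  moreover have "closed S"
    unfolding S_def by (rule closed_translation_invariance[OF \<mu> sets])
  moreover have "x \<in> S"
    using inv by (simp add: S_def)
  ultimately have "smallest_closed_subgroup x \<subseteq> S"
    unfolding smallest_closed_subgroup_def by (intro hull_minimal) auto
  then have "emeasure \<mu> ((+) h ` A) = emeasure \<mu> A"
    if "h \<in> smallest_closed_subgroup x" "A \<in> sets borel" for h A
    using that emeasure_distr_add[OF sets, of A h] is_subgroup_smallest_closed_subgroup[of x]
    by (auto simp: is_subgroup_def S_def)
  then show ?thesis
    using \<mu> sets H by (simp add: is_normalized_haar_def)
qed

text \<open>The definition demands invariance only for Borel subsets of \<open>H\<close>. As
  \<open>\<mu>\<close> is carried by \<open>H\<close>, any Borel set may be cut down to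
  \<open>H\<close>, and translation by \<open>- h\<close> commutes with this cut.\<close>

lemma is_normalized_haar_imp_translation_invariant:
  fixes \<mu> :: "'a::{topological_ab_group_add, second_countable_topology} measure"
  assumes haar: "is_normalized_haar H \<mu>" and H: "closed H" "is_subgroup H" and h: "h \<in> H"
  shows "distr \<mu> borel ((+) h) = \<mu>"
proof (rule measure_eqI)
  have sets [measurable_cong]: "sets \<mu> = sets borel" and \<mu>: "prob_space \<mu>" and 1: "emeasure \<mu> H = 1"
    using haar by (auto simp: is_normalized_haar_def)
  then show "sets (distr \<mu> borel ((+) h)) = sets \<mu>"
    by simp
  interpret prob_space \<mu> by fact
  have [measurable]: "H \<in> sets borel"
    using H by simp
  have AE_H: "AE y in \<mu>. y \<in> H"
    using 1 by (intro AE_I_eq_1) (auto simp: sets Int_def sets_eq_imp_space_eq[OF sets])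
  fix A assume "A \<in> sets (distr \<mu> borel ((+) h))"
  then have A [measurable]: "A \<in> sets borel"
    by simp
  have m: "- h \<in> H"
    using H h by (auto simp: is_subgroup_def)
  have restrict: "emeasure \<mu> B = emeasure \<mu> (B \<inter> H)" if [measurable]: "B \<in> sets borel" for B
    using AE_H by (intro emeasure_eq_AE) (auto elim!: eventually_mono)
  have tr: "(+) (- h) ` B \<in> sets borel" if "B \<in> sets borel" for B
  proof -
    have "(+) (- h) ` B = (+) h -` B"
    proof (intro set_eqI iffI)
      fix y assume "y \<in> (+) h -` B"
      then have "y = - h + (h + y)" "h + y \<in> B"
        by simp_all
      then show "y \<in> (+) (- h) ` B"
        by blast
    qed auto
    moreover have "(+) h \<in> borel_measurable borel"
      by measurable
    ultimately show ?thesis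
      using that measurable_sets[of "(+) h" borel borel B] by simp
  qed
  have "emeasure (distr \<mu> borel ((+) h)) A = emeasure \<mu> ((+) (- h) ` A)"
    using emeasure_distr_add[OF sets A, of "- h"] by simp
  also have "\<dots> = emeasure \<mu> ((+) (- h) ` A \<inter> H)"
    by (rule restrict) (rule tr[OF A])
  also have "(+) (- h) ` A \<inter> H = (+) (- h) ` (A \<inter> H)"
  proof (intro set_eqI iffI)
    fix y assume "y \<in> (+) (- h) ` A \<inter> H"
    then obtain a where a: "a \<in> A" "y = - h + a" "y \<in> H"
      by auto
    then have "h + y \<in> H" "h + y = a"
      using H(2) h unfolding is_subgroup_def by (blast, simp)
    then show "y \<in> (+) (- h) ` (A \<inter> H)"
      using a by blast
  next
    fix y assume "y \<in> (+) (- h) ` (A \<inter> H)"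
    then show "y \<in> (+) (- h) ` A \<inter> H"
      using H m by (auto simp: is_subgroup_def simp del: uminus_add_conv_diff)
  qed
  also have "emeasure \<mu> \<dots> = emeasure \<mu> (A \<inter> H)"
    using haar m A by (auto simp: is_normalized_haar_def simp del: uminus_add_conv_diff)
  also have "\<dots> = emeasure \<mu> A"
    by (rule restrict[symmetric]) (rule A)
  finally show "emeasure (distr \<mu> borel ((+) h)) A = emeasure \<mu> A" .
qed

text \<open>Integrate the indicator of \<open>A\<close> at \<open>y + z\<close> over both measures.
  The inner integral is almost everywhere constant, equal to \<open>emeasure \<mu> A\<close> in one
  order and to \<open>emeasure \<nu> A\<close> in the other.\<close>

lemma is_normalized_haar_unique:
  fixes \<mu> \<nu> :: "'a::{topological_ab_group_add, second_countable_topology} measure"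
  assumes \<mu>: "is_normalized_haar H \<mu>" and \<nu>: "is_normalized_haar H \<nu>"
    and H: "closed H" "is_subgroup H"
  shows "\<mu> = \<nu>"
proof (rule measure_eqI)
  have sets [measurable_cong]: "sets \<mu> = sets borel" "sets \<nu> = sets borel"
    and prob: "prob_space \<mu>" "prob_space \<nu>" and 1: "emeasure \<mu> H = 1" "emeasure \<nu> H = 1"
    using \<mu> \<nu> by (auto simp: is_normalized_haar_def)
  then show "sets \<mu> = sets \<nu>"
    by simp
  interpret M: prob_space \<mu> by (rule prob)
  interpret N: prob_space \<nu> by (rule prob)
  interpret pair_sigma_finite \<mu> \<nu> ..
  have [measurable]: "H \<in> sets borel"
    using H by simp
  have AE_H: "AE y in \<mu>. y \<in> H" "AE y in \<nu>. y \<in> H"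
    using 1 by (auto intro!: M.AE_I_eq_1 N.AE_I_eq_1 simp: sets Int_def sets_eq_imp_space_eq[OF sets(1)] sets_eq_imp_space_eq[OF sets(2)])
  fix A assume "A \<in> sets \<mu>"
  then have A [measurable]: "A \<in> sets borel"
    by (simp add: sets)
  have shift: "(\<integral>\<^sup>+ z. indicator A (h + z) \<partial>\<rho>) = emeasure \<rho> A"
    if \<rho>: "is_normalized_haar H \<rho>" and h: "h \<in> H" for \<rho> h
  proof -
    have [measurable_cong]: "sets \<rho> = sets borel"
      using \<rho> by (simp add: is_normalized_haar_def)
    have "(\<integral>\<^sup>+ z. indicator A (h + z) \<partial>\<rho>) = (\<integral>\<^sup>+ z. indicator A z \<partial>distr \<rho> borel ((+) h))"
      by (subst nn_integral_distr) auto
    then show ?thesis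
      using is_normalized_haar_imp_translation_invariant[OF \<rho> H h] A
      by (simp add: \<open>sets \<rho> = sets borel\<close>)
  qed
  have "emeasure \<mu> A = (\<integral>\<^sup>+ y. emeasure \<mu> A \<partial>\<nu>)"
    by (simp add: N.emeasure_space_1)
  also have "\<dots> = (\<integral>\<^sup>+ y. \<integral>\<^sup>+ z. indicator A (y + z) \<partial>\<mu> \<partial>\<nu>)"
    using AE_H(2) by (intro nn_integral_cong_AE) (auto simp: shift[OF \<mu>] elim!: eventually_mono)
  also have "\<dots> = (\<integral>\<^sup>+ z. \<integral>\<^sup>+ y. indicator A (z + y) \<partial>\<nu> \<partial>\<mu>)"
    by (subst Fubini') (auto simp: add.commute)
  also have "\<dots> = (\<integral>\<^sup>+ z. emeasure \<nu> A \<partial>\<mu>)"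
    using AE_H(1) by (intro nn_integral_cong_AE) (auto simp: shift[OF \<nu>] elim!: eventually_mono)
  also have "\<dots> = emeasure \<nu> A"
    by (simp add: M.emeasure_space_1)
  finally show "emeasure \<mu> A = emeasure \<nu> A" .
qed

text \<open>
  On the cyclic group generated by \<open>x\<close>, regarded as a discrete group, the compound Poisson measure
  has the Fourier transform \<open>exp (c * (\<zeta> - 1))\<close>, which vanishes nowhere and determines \<open>c\<close>; neither
  duality on the topological group nor continuity of the character is needed.
\<close>

lemma cyclic_character_test_function:
  fixes x :: "'a::topological_ab_group_add"
  assumes sing: "\<And>y::'a. {y} \<in> sets borel" and "x \<noteq> 0"
  obtains \<zeta> :: complex and F :: "'a \<Rightarrow> complex" where "norm \<zeta> = 1" "\<zeta> \<noteq> 1"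
    "F \<in> borel_measurable borel" "\<And>k. F (multiple k x) = \<zeta> ^ k"
proof -
  obtain \<zeta> :: complex where \<zeta>: "norm \<zeta> = 1" "\<zeta> \<noteq> 1"
    "\<And>j k. multiple j x = multiple k x \<Longrightarrow> \<zeta> ^ j = \<zeta> ^ k"
    using ex_cyclic_character[OF \<open>x \<noteq> 0\<close>] by metis
  define R where "R = range (\<lambda>k. multiple k x)"
  define F where "F y = (if y \<in> R then \<zeta> ^ (SOME k. y = multiple k x) else 0)" for y
  have "F \<in> borel_measurable borel"
  \<comment> \<open>\<open>F\<close> differs from 0 only on the countable set \<open>R\<close>,
    whose points are Borel sets.\<close>
  proof (rule measurable_discrete_difference[where f = "\<lambda>_. 0" and X = R])
    show "countable R"
      by (simp add: R_def)
  qed (auto simp: F_def sing)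
  moreover have "F (multiple k x) = \<zeta> ^ k" for k
  proof -
    have "multiple k x = multiple (SOME j. multiple k x = multiple j x) x"
      by (rule someI) (rule refl)
    from \<zeta>(3)[OF this] show ?thesis
      by (simp add: F_def R_def)
  qed
  ultimately show ?thesis
    using that \<zeta> by blast
qed

text \<open>Translation by \<open>x\<close> multiplies the transform at \<open>\<zeta>\<close> by
  \<open>\<zeta> \<noteq> 1\<close>, so invariance would make the transform 0; but it is an
  exponential.\<close>

lemma compound_poisson_not_translation_invariant:
  fixes x :: "'a::{topological_ab_group_add, second_countable_topology}"
  assumes sing: "\<And>y::'a. {y} \<in> sets borel" and "x \<noteq> 0" and c: "c \<ge> 0"
    and P: "P = compound_poisson (scale_measure (ennreal c) (return borel x))"
  shows "distr P borel ((+) x) \<noteq> P"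
proof
  assume inv: "distr P borel ((+) x) = P"
  obtain q where q: "\<And>k. pmf q k = c ^ k / fact k * exp (- c)"
    using ex_poisson_pmf[OF c] by blast
  have P_q: "P = distr (measure_pmf q) borel (\<lambda>k. multiple k x)"
    unfolding P by (rule compound_poisson_point_mass[OF c q])
  obtain \<zeta> :: complex and F where \<zeta>: "norm \<zeta> = 1" "\<zeta> \<noteq> 1"
    and [measurable]: "F \<in> borel_measurable borel" and F: "\<And>k. F (multiple k x) = \<zeta> ^ k"
    using cyclic_character_test_function[OF sing \<open>x \<noteq> 0\<close>] by metis
  have "integral\<^sup>L P F = measure_pmf.expectation q (\<lambda>k. \<zeta> ^ k)"
    by (simp add: P_q integral_distr F)
  moreover have "integral\<^sup>L (distr P borel ((+) x)) F = \<zeta> * measure_pmf.expectation q (\<lambda>k. \<zeta> ^ k)"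
  proof -
    have "integral\<^sup>L (distr P borel ((+) x)) F = measure_pmf.expectation q (\<lambda>k. F (multiple (Suc k) x))"
      unfolding P_q by (subst distr_distr) (auto simp: integral_distr comp_def)
    then show ?thesis
      unfolding F by simp
  qed
  ultimately have "(\<zeta> - 1) * measure_pmf.expectation q (\<lambda>k. \<zeta> ^ k) = 0"
    using inv by (simp add: algebra_simps)
  then show False
    using \<zeta> by (simp add: expectation_poisson_power[OF \<zeta>(1) q])
qed

text \<open>Comparing moduli avoids the periods of the complex exponential:
  \<open>exp (c * (Re \<zeta> - 1))\<close> determines \<open>c\<close>, as
  \<open>Re \<zeta> = 1\<close> would force \<open>\<zeta> = 1\<close> on the unit circle.\<close>

lemma compound_poisson_point_mass_inject:
  fixes x :: "'a::{topological_ab_group_add, second_countable_topology}"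
  assumes sing: "\<And>y::'a. {y} \<in> sets borel" and "x \<noteq> 0" and cd: "c \<ge> 0" "d \<ge> 0"
    and eq: "compound_poisson (scale_measure (ennreal c) (return borel x)) =
      compound_poisson (scale_measure (ennreal d) (return borel x))"
  shows "c = d"
proof -
  obtain \<zeta> :: complex and F where \<zeta>: "norm \<zeta> = 1" "\<zeta> \<noteq> 1"
    and [measurable]: "F \<in> borel_measurable borel" and F: "\<And>k. F (multiple k x) = \<zeta> ^ k"
    using cyclic_character_test_function[OF sing \<open>x \<noteq> 0\<close>] by metis
  have fourier: "integral\<^sup>L (compound_poisson (scale_measure (ennreal b) (return borel x))) F =
      exp (of_real b * (\<zeta> - 1))" if b: "b \<ge> 0" for b
  proof -
    obtain q where q: "\<And>k. pmf q k = b ^ k / fact k * exp (- b)"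
      using ex_poisson_pmf[OF b] by blast
    show ?thesis
      by (simp add: compound_poisson_point_mass[OF b q] integral_distr F
          expectation_poisson_power[OF \<zeta>(1) q])
  qed
  have "norm (exp (of_real c * (\<zeta> - 1))) = norm (exp (of_real d * (\<zeta> - 1)))"
    using fourier cd eq by metis
  then have "c * (Re \<zeta> - 1) = d * (Re \<zeta> - 1)"
    by (simp add: norm_exp_eq_Re)
  moreover have "Re \<zeta> \<noteq> 1"
  proof
    assume "Re \<zeta> = 1"
    then have "Im \<zeta> = 0"
      using \<zeta>(1) cmod_power2[of \<zeta>] by simp
    then show False
      using \<open>Re \<zeta> = 1\<close> \<zeta>(2) by (simp add: complex_eq_iff)
  qed
  ultimately show "c = d"
    by simp
qed

section \<open>Weak limits of binomial multiples\<close>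

text \<open>The extended reals are sequentially compact: terms staying outside a neighbourhood of
  \<open>L\<close> would have a convergent subsequence, whose limit is not \<open>L\<close>.\<close>

lemma tendsto_ereal_subsequence_limits:
  fixes X :: "nat \<Rightarrow> ereal"
  assumes "\<And>r l. strict_mono r \<Longrightarrow> (\<lambda>n. X (r n)) \<longlonglongrightarrow> l \<Longrightarrow> l = L"
  shows "X \<longlonglongrightarrow> L"
proof (rule ccontr)
  assume "\<not> X \<longlonglongrightarrow> L"
  then obtain U where U: "open U" "L \<in> U" and "\<not> eventually (\<lambda>n. X n \<in> U) sequentially"
    by (auto simp: tendsto_def)
  then have inf: "infinite {n. X n \<notin> U}"
    using eventually_cofinite[of "\<lambda>n. X n \<in> U"] by (simp add: cofinite_eq_sequentially)
  define s where "s = enumerate {n. X n \<notin> U}"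
  have s: "strict_mono s" "\<And>n. X (s n) \<notin> U"
    using strict_mono_enumerate[OF inf] enumerate_in_set[OF inf] by (auto simp: s_def)
  obtain l r where r: "strict_mono r" "(X \<circ> s \<circ> r) \<longlonglongrightarrow> l"
    using compact_complete_linorder[of "X \<circ> s"] by auto
  have "l = L"
    using r strict_mono_o[OF s(1) r(1)] by (intro assms[of "s \<circ> r"]) (auto simp: comp_def)
  then have "eventually (\<lambda>n. X (s (r n)) \<in> U) sequentially"
    using r(2) U by (auto simp: tendsto_def comp_def)
  then show False
    using s(2) by (simp add: eventually_sequentially)
qed

context
  fixes x :: "'a::{topological_ab_group_add, second_countable_topology}"
begin

text \<open>The expectations of \<open>f\<close> at \<open>multiple (N + 1) x\<close> and at
  \<open>multiple N x\<close> converge to the two integrals to be compared, while their difference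
  tends to 0.\<close>

lemma binomial_limit_translation_invariant:
  fixes p :: "nat \<Rightarrow> real" and K :: "nat \<Rightarrow> nat" and \<nu> :: "'a measure"
  assumes p: "p \<longlonglongrightarrow> 0" and Kp: "filterlim (\<lambda>n. real (K n) * p n) at_top sequentially"
    and \<nu>: "prob_space \<nu>" "sets \<nu> = sets borel"
    and lim: "\<And>f::'a \<Rightarrow> real. continuous_on UNIV f \<Longrightarrow> bounded (range f) \<Longrightarrow>
      (\<lambda>n. measure_pmf.expectation (binomial_pmf (K n) (p n)) (\<lambda>k. f (multiple k x))) \<longlonglongrightarrow> integral\<^sup>L \<nu> f"
  shows "distr \<nu> borel ((+) x) = \<nu>"
proof (rule measure_eqI_bounded_continuous[OF regular_space_topological_group])
  note [measurable_cong] = \<nu>(2)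
  show "finite_measure (distr \<nu> borel ((+) x))"
    by (intro prob_space.finite_measure prob_space.prob_space_distr \<nu>) measurable
  show "finite_measure \<nu>"
    using \<nu>(1) by (rule prob_space.finite_measure)
  fix f :: "'a \<Rightarrow> real" assume f: "continuous_on UNIV f" "bounded (range f)"
  then have [measurable]: "f \<in> borel_measurable borel"
    by (intro borel_measurable_continuous_onI)
  have "continuous_on UNIV (\<lambda>y. f (x + y))"
    by (rule continuous_on_compose2[OF f(1)]) (auto intro!: continuous_intros)
  moreover have "bounded (range (\<lambda>y. f (x + y)))"
    using f(2) by (rule bounded_subset) auto
  ultimately have "(\<lambda>n. measure_pmf.expectation (binomial_pmf (K n) (p n)) (\<lambda>k. f (multiple (Suc k) x)) -
      measure_pmf.expectation (binomial_pmf (K n) (p n)) (\<lambda>k. f (multiple k x)))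
    \<longlonglongrightarrow> (\<integral>y. f (x + y) \<partial>\<nu>) - integral\<^sup>L \<nu> f"
    using lim[of "\<lambda>y. f (x + y)"] lim[OF f] by (auto intro!: tendsto_diff)
  moreover have "bounded (range (\<lambda>k. f (multiple k x)))"
    using f(2) by (rule bounded_subset) auto
  ultimately have "(\<integral>y. f (x + y) \<partial>\<nu>) - integral\<^sup>L \<nu> f = 0"
    using tendsto_expectation_binomial_shift[OF p Kp] LIMSEQ_unique by blast
  then show "integral\<^sup>L (distr \<nu> borel ((+) x)) f = integral\<^sup>L \<nu> f"
    by (simp add: integral_distr)
qed (simp_all add: \<nu>)

lemma binomial_limit_compound_poisson:
  fixes p :: "nat \<Rightarrow> real" and K :: "nat \<Rightarrow> nat" and f :: "'a \<Rightarrow> real"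
  assumes p: "p \<longlonglongrightarrow> 0" "eventually (\<lambda>n. 0 \<le> p n) sequentially"
    and K: "filterlim K at_top sequentially"
    and Kp: "(\<lambda>n. real (K n) * p n) \<longlonglongrightarrow> c" and c: "c \<ge> 0"
    and f: "f \<in> borel_measurable borel" "bounded (range f)"
  shows "(\<lambda>n. measure_pmf.expectation (binomial_pmf (K n) (p n)) (\<lambda>k. f (multiple k x)))
    \<longlonglongrightarrow> integral\<^sup>L (compound_poisson (scale_measure (ennreal c) (return borel x))) f"
proof -
  obtain q where q: "\<And>k. pmf q k = c ^ k / fact k * exp (- c)"
    using ex_poisson_pmf[OF c] by blast
  have b: "bounded (range (\<lambda>k. f (multiple k x)))"
    using f(2) by (rule bounded_subset) auto
  have "integral\<^sup>L (compound_poisson (scale_measure (ennreal c) (return borel x))) f =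
      measure_pmf.expectation q (\<lambda>k. f (multiple k x))"
    using f(1) by (simp add: compound_poisson_point_mass[OF c q] integral_distr)
  also have "\<dots> = (\<Sum>k. (c ^ k / fact k * exp (- c)) *\<^sub>R f (multiple k x))"
    using sums_unique[OF sums_expectation_nat_pmf[OF b, of q]] by (simp add: q)
  finally show ?thesis
    using tendsto_expectation_binomial_poisson[OF p K Kp b] by simp
qed

lemma prob_space_compound_poisson:
  assumes c: "c \<ge> 0"
  shows "prob_space (compound_poisson (scale_measure (ennreal c) (return borel x)))"
proof -
  obtain q where q: "\<And>k. pmf q k = c ^ k / fact k * exp (- c)"
    using ex_poisson_pmf[OF c] by blast
  show ?thesis
    unfolding compound_poisson_point_mass[OF c q] by (rule measure_pmf.prob_space_distr) simp
qed

text \<open>Serves twice: for the existence of normalized Haar measure and for the convergence of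
  the row sums to it.\<close>

lemma binomial_compact_subsequence_haar:
  fixes p :: "nat \<Rightarrow> real" and K :: "nat \<Rightarrow> nat"
  assumes haus: "Hausdorff_space (euclidean :: 'a topology)"
    and cpt: "compact (smallest_closed_subgroup x)"
    and p: "p \<longlonglongrightarrow> 0" and Kp: "filterlim (\<lambda>n. real (K n) * p n) at_top sequentially"
  obtains r :: "nat \<Rightarrow> nat" and \<nu> :: "'a measure"
  where "strict_mono r" "is_normalized_haar (smallest_closed_subgroup x) \<nu>"
    "\<And>f::'a \<Rightarrow> real. continuous_on UNIV f \<Longrightarrow> bounded (range f) \<Longrightarrow>
      (\<lambda>n. measure_pmf.expectation (binomial_pmf (K (r n)) (p (r n))) (\<lambda>k. f (multiple k x)))
        \<longlonglongrightarrow> integral\<^sup>L \<nu> f"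
proof -
  have range: "range (\<lambda>k. multiple k x) \<subseteq> smallest_closed_subgroup x"
    using multiple_mem_subgroup[OF is_subgroup_smallest_closed_subgroup mem_smallest_closed_subgroup] by auto
  obtain r :: "nat \<Rightarrow> nat" and \<nu> :: "'a measure"
    where r: "strict_mono r"
      and \<nu>: "prob_space \<nu>" "sets \<nu> = sets borel" "emeasure \<nu> (smallest_closed_subgroup x) = 1"
      and lim: "\<And>f::'a \<Rightarrow> real. continuous_on UNIV f \<Longrightarrow> bounded (range f) \<Longrightarrow>
        (\<lambda>n. measure_pmf.expectation (binomial_pmf (K (r n)) (p (r n))) (\<lambda>k. f (multiple k x)))
          \<longlonglongrightarrow> integral\<^sup>L \<nu> f"
    by (rule compact_support_weakly_convergent_subsequence[OF haus cpt range,
        where q = "\<lambda>n. binomial_pmf (K n) (p n)"], rule that)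
  have "distr \<nu> borel ((+) x) = \<nu>"
  proof (rule binomial_limit_translation_invariant[where p = "\<lambda>n. p (r n)" and K = "\<lambda>n. K (r n)"])
    show "(\<lambda>n. p (r n)) \<longlonglongrightarrow> 0" "filterlim (\<lambda>n. real (K (r n)) * p (r n)) at_top sequentially"
      using filterlim_compose[OF p filterlim_subseq[OF r]] filterlim_compose[OF Kp filterlim_subseq[OF r]]
      by auto
  qed (use \<nu> lim in auto)
  then have "is_normalized_haar (smallest_closed_subgroup x) \<nu>"
    using \<nu> by (intro is_normalized_haar_translation_invariant)
  then show ?thesis
    by (rule that[OF r _ lim])
qed

lemma is_normalized_haar_haar_measure:
  assumes haus: "Hausdorff_space (euclidean :: 'a topology)"
    and cpt: "compact (smallest_closed_subgroup x)"
  shows "is_normalized_haar (smallest_closed_subgroup x) (haar_measure (smallest_closed_subgroup x))"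
proof -
  \<comment> \<open>Any choice with \<open>p n\<close> tending to 0 and \<open>K n * p n\<close> to
    infinity would do; here the product is \<open>n + 1\<close>.\<close>
  define p where "p n = 1 / real (Suc n)" for n
  define K where "K n = (Suc n)\<^sup>2" for n
  have p: "p \<longlonglongrightarrow> 0"
    unfolding p_def by (rule LIMSEQ_Suc[OF lim_1_over_n])
  have "real (K n) * p n = real (Suc n)" for n
    unfolding K_def p_def of_nat_power by (simp add: power2_eq_square del: of_nat_Suc)
  then have Kp: "filterlim (\<lambda>n. real (K n) * p n) at_top sequentially"
    using filterlim_compose[OF filterlim_real_sequentially filterlim_Suc] by simp
  obtain \<nu> :: "'a measure" where \<nu>: "is_normalized_haar (smallest_closed_subgroup x) \<nu>"
    by (rule binomial_compact_subsequence_haar[OF haus cpt p Kp])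
  show ?thesis
    unfolding haar_measure_def
    using \<nu> is_normalized_haar_unique[OF _ \<nu> closed_smallest_closed_subgroup is_subgroup_smallest_closed_subgroup]
    by (rule theI)
qed

text \<open>Since a compound Poisson law of a point mass at \<open>x \<noteq> 0\<close> is not
  invariant under \<open>x\<close>, the two cases exclude each other there: the weak limit tells
  which subsequence limits of \<open>K n * p n\<close> can occur.\<close>

lemma binomial_weak_limit_cases [consumes 8, case_names infinite finite]:
  fixes p :: "nat \<Rightarrow> real" and K :: "nat \<Rightarrow> nat" and \<nu> :: "'a measure"
  assumes p: "p \<longlonglongrightarrow> 0" "eventually (\<lambda>n. 0 \<le> p n) sequentially"
    and K: "filterlim K at_top sequentially"
    and \<nu>: "prob_space \<nu>" "sets \<nu> = sets borel"
    and lim: "\<forall>f::'a \<Rightarrow> real. continuous_on UNIV f \<and> bounded (range f) \<longrightarrow>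
      (\<lambda>n. measure_pmf.expectation (binomial_pmf (K n) (p n)) (\<lambda>k. f (multiple k x))) \<longlonglongrightarrow> integral\<^sup>L \<nu> f"
    and r: "strict_mono r" and l: "(\<lambda>n. ereal (real (K (r n)) * p (r n))) \<longlonglongrightarrow> l"
  obtains (infinite) "l = \<infinity>" "distr \<nu> borel ((+) x) = \<nu>"
  | (finite) c where "c \<ge> 0" "l = ereal c" "\<nu> = compound_poisson (scale_measure (ennreal c) (return borel x))"
proof -
  have sub: "(\<lambda>n. p (r n)) \<longlonglongrightarrow> 0" "eventually (\<lambda>n. 0 \<le> p (r n)) sequentially"
    "filterlim (\<lambda>n. K (r n)) at_top sequentially"
    using filterlim_compose[OF p(1) filterlim_subseq[OF r]] eventually_subseq[OF r p(2)]
      filterlim_compose[OF K filterlim_subseq[OF r]] by auto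
  have lim': "(\<lambda>n. measure_pmf.expectation (binomial_pmf (K (r n)) (p (r n))) (\<lambda>k. f (multiple k x)))
      \<longlonglongrightarrow> integral\<^sup>L \<nu> f" if "continuous_on UNIV f" "bounded (range f)" for f :: "'a \<Rightarrow> real"
    using filterlim_compose[OF lim[rule_format, OF conjI, OF that] filterlim_subseq[OF r]] .
  have "l \<ge> 0"
    using l by (rule tendsto_lowerbound) (use sub(2) in \<open>auto elim!: eventually_mono\<close>)
  show ?thesis
  proof (cases l)
    case (real c)
    then have c: "c \<ge> 0" and Kp: "(\<lambda>n. real (K (r n)) * p (r n)) \<longlonglongrightarrow> c"
      using \<open>l \<ge> 0\<close> l by auto
    have "\<nu> = compound_poisson (scale_measure (ennreal c) (return borel x))"
    proof (rule measure_eqI_bounded_continuous[OF regular_space_topological_group])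
      fix f :: "'a \<Rightarrow> real" assume f: "continuous_on UNIV f" "bounded (range f)"
      show "integral\<^sup>L \<nu> f = integral\<^sup>L (compound_poisson (scale_measure (ennreal c) (return borel x))) f"
        using lim'[OF f] binomial_limit_compound_poisson[OF sub Kp c borel_measurable_continuous_onI[OF f(1)] f(2)]
        by (rule LIMSEQ_unique)
    qed (use \<nu> c in \<open>auto intro: prob_space.finite_measure prob_space_compound_poisson\<close>)
    then show ?thesis
      using finite real c by blast
  next
    case PInf
    then have "filterlim (\<lambda>n. real (K (r n)) * p (r n)) at_top sequentially"
      using l by (simp add: tendsto_PInfty_eq_at_top)
    then have "distr \<nu> borel ((+) x) = \<nu>"
      using sub \<nu> lim' by (intro binomial_limit_translation_invariant[where p = "\<lambda>n. p (r n)" and K = "\<lambda>n. K (r n)"])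
    then show ?thesis
      using infinite PInf by blast
  qed (use \<open>l \<ge> 0\<close> in auto)
qed

end

section \<open>Row sums as binomial multiples of the point, and the three assertions\<close>

theorem theorem5p1:
  fixes x :: "'a::{topological_ab_group_add, t0_space, second_countable_topology}"
    and M :: "'b measure"
    and K :: "nat \<Rightarrow> nat"
    and X :: "nat \<Rightarrow> nat \<Rightarrow> 'b \<Rightarrow> 'a"
    and p :: "nat \<Rightarrow> real"
  assumes locally_compact: "locally_compact_space (euclidean :: 'a topology)"
    and x: "x \<noteq> 0"
    and M: "prob_space M"
    and random_elements: "\<And>n k. n \<ge> 1 \<Longrightarrow> k \<in> {1..K n} \<Longrightarrow> X n k \<in> borel_measurable M"
    and independent: "\<And>n. n \<ge> 1 \<Longrightarrow> prob_space.indep_vars M (\<lambda>_. borel) (X n) {1..K n}"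
    and identically_distributed:
      "\<And>n j k. n \<ge> 1 \<Longrightarrow> j \<in> {1..K n} \<Longrightarrow> k \<in> {1..K n} \<Longrightarrow>
         distr M borel (X n j) = distr M borel (X n k)"
    and K: "filterlim K at_top sequentially"
    and prob_x: "\<And>n k. n \<ge> 1 \<Longrightarrow> k \<in> {1..K n} \<Longrightarrow>
         measure M {\<omega> \<in> space M. X n k \<omega> = x} = p n"
    and prob_0: "\<And>n k. n \<ge> 1 \<Longrightarrow> k \<in> {1..K n} \<Longrightarrow>
         measure M {\<omega> \<in> space M. X n k \<omega> = 0} = 1 - p n"
    and p: "p \<longlonglongrightarrow> 0"
  shows "infinitesimal_array M K X \<and>
    (\<forall>l::real. l \<ge> 0 \<longrightarrow>
       (weakly_converges (\<lambda>n. distr M borel (\<lambda>\<omega>. \<Sum>k=1..K n. X n k \<omega>))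
          (compound_poisson (scale_measure (ennreal l) (return borel x)))
        \<longleftrightarrow> (\<lambda>n. real (K n) * p n) \<longlonglongrightarrow> l)) \<and>
    (compact (smallest_closed_subgroup x) \<longrightarrow>
       (weakly_converges (\<lambda>n. distr M borel (\<lambda>\<omega>. \<Sum>k=1..K n. X n k \<omega>))
          (haar_measure (smallest_closed_subgroup x))
        \<longleftrightarrow> filterlim (\<lambda>n. real (K n) * p n) at_top sequentially))"
proof -
  interpret prob_space M by (rule M)
  let ?S = "\<lambda>n. distr M borel (\<lambda>\<omega>. \<Sum>k=1..K n. X n k \<omega>)"
  let ?E = "\<lambda>n f. measure_pmf.expectation (binomial_pmf (K n) (p n)) (\<lambda>k. f (multiple k x))"
  let ?e = "\<lambda>c::real. compound_poisson (scale_measure (ennreal c) (return borel x))"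
  let ?H = "smallest_closed_subgroup x"
  have haus: "Hausdorff_space (euclidean :: 'a topology)"
    by (rule Hausdorff_space_regular_t0[OF regular_space_topological_group])
  have sing: "{y::'a} \<in> sets borel" for y
    using closedin_Hausdorff_singleton[OF haus, of y] by simp
  have "eventually (\<lambda>n. 1 \<le> K n) sequentially"
    using K by (auto simp: filterlim_at_top)
  \<comment> \<open>Row 0 is not constrained, and an empty row says nothing about
    \<open>p n\<close>; eventually neither occurs.\<close>
  then have ev: "eventually (\<lambda>n. n \<ge> 1 \<and> K n \<ge> 1) sequentially"
    using eventually_ge_at_top[of 1] by eventually_elim simp
  have p01: "p n \<in> {0..1}" if "n \<ge> 1 \<and> K n \<ge> 1" for n
  proof -
    have "0 \<le> p n" "0 \<le> 1 - p n"
      using prob_x[of n 1] prob_0[of n 1] that measure_nonneg by (metis atLeastAtMost_iff order_refl)+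
    then show ?thesis
      by simp
  qed
  have p_nonneg: "eventually (\<lambda>n. 0 \<le> p n) sequentially"
    using ev by eventually_elim (use p01 in auto)
  have law: "?S n = distr (measure_pmf (binomial_pmf (K n) (p n))) borel (\<lambda>k. multiple k x)"
    if "n \<ge> 1 \<and> K n \<ge> 1" for n
    using that p01 by (intro distr_sum_two_point sing x random_elements independent prob_x prob_0) auto
  have weak_iff: "weakly_converges ?S \<nu> \<longleftrightarrow>
      (\<forall>f::'a \<Rightarrow> real. continuous_on UNIV f \<and> bounded (range f) \<longrightarrow> (\<lambda>n. ?E n f) \<longlonglongrightarrow> integral\<^sup>L \<nu> f)" for \<nu>
  proof -
    have "(\<lambda>n. integral\<^sup>L (?S n) f) \<longlonglongrightarrow> L \<longleftrightarrow> (\<lambda>n. ?E n f) \<longlonglongrightarrow> L"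
      if f: "continuous_on UNIV f" for f :: "'a \<Rightarrow> real" and L
    proof (rule tendsto_cong)
      have "f \<in> borel_measurable borel"
        using f by (rule borel_measurable_continuous_onI)
      then have "integral\<^sup>L (?S n) f = ?E n f" if "n \<ge> 1 \<and> K n \<ge> 1" for n
        unfolding law[OF that] by (simp add: integral_distr)
      with ev show "eventually (\<lambda>n. integral\<^sup>L (?S n) f = ?E n f) sequentially"
        by (auto elim: eventually_mono)
    qed
    then show ?thesis
      by (auto simp: weakly_converges_def)
  qed

  have "infinitesimal_array M K X"
    unfolding infinitesimal_array_def
  proof (intro allI impI)
    fix U :: "'a set" assume "borel_nhd_zero U"
    then have "0 \<in> U" and U: "U \<in> sets borel"
      by (auto simp: borel_nhd_zero_def)
    let ?P = "\<lambda>n k. prob {\<omega> \<in> space M. X n k \<omega> \<in> - U}"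
    \<comment> \<open>As \<open>0 \<in> U\<close>, leaving \<open>U\<close> means taking a nonzero
      value.\<close>
    have le: "?P n k \<le> p n" if "n \<ge> 1" "k \<in> {1..K n}" for n k
    proof -
      note [measurable] = random_elements[OF that] sing
      have "?P n k \<le> prob (space M - {\<omega> \<in> space M. X n k \<omega> \<in> {0}})"
        using \<open>0 \<in> U\<close> by (intro finite_measure_mono) auto
      also have "\<dots> = p n"
        by (subst prob_compl) (use prob_0[OF that] in auto)
      finally show ?thesis .
    qed
    have "eventually (\<lambda>n. norm (MAX k\<in>{1..K n}. ?P n k) \<le> p n) sequentially"
      using ev
    proof eventually_elim
      case (elim n)
      then have ne: "(\<lambda>k. ?P n k) ` {1..K n} \<noteq> {}"
        by simp
      then have "(MAX k\<in>{1..K n}. ?P n k) \<in> (\<lambda>k. ?P n k) ` {1..K n}"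
        by (intro Max_in) auto
      then obtain k where k: "k \<in> {1..K n}" "(MAX k\<in>{1..K n}. ?P n k) = ?P n k"
        by (rule imageE)
      show ?case
        unfolding k(2) using le[OF _ k(1)] elim by simp
    qed
    then show "(\<lambda>n. MAX k\<in>{1..K n}. ?P n k) \<longlonglongrightarrow> 0"
      by (rule Lim_null_comparison) (rule p)
  qed
  moreover have "weakly_converges ?S (?e c) \<longleftrightarrow> (\<lambda>n. real (K n) * p n) \<longlonglongrightarrow> c" if c: "c \<ge> 0" for c
  proof
    assume "weakly_converges ?S (?e c)"
    then have lim: "\<forall>f::'a \<Rightarrow> real. continuous_on UNIV f \<and> bounded (range f) \<longrightarrow>
        (\<lambda>n. ?E n f) \<longlonglongrightarrow> integral\<^sup>L (?e c) f"
      unfolding weak_iff .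
    \<comment> \<open>An infinite subsequence limit would make the compound Poisson law invariant
      under \<open>x\<close>; a finite one is determined by the law.\<close>
    have "(\<lambda>n. ereal (real (K n) * p n)) \<longlonglongrightarrow> ereal c"
    proof (rule tendsto_ereal_subsequence_limits)
      fix r l assume "strict_mono r" "(\<lambda>n. ereal (real (K (r n)) * p (r n))) \<longlonglongrightarrow> l"
      with p p_nonneg K prob_space_compound_poisson[OF c] sets_compound_poisson lim
      show "l = ereal c"
      proof (cases rule: binomial_weak_limit_cases)
        case infinite
        then show ?thesis
          using compound_poisson_not_translation_invariant[OF sing x c] by blast
      next
        case (finite d)
        then show ?thesis
          using compound_poisson_point_mass_inject[OF sing x c] by blast
      qed
    qed
    then show "(\<lambda>n. real (K n) * p n) \<longlonglongrightarrow> c"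
      by simp
  next
    assume "(\<lambda>n. real (K n) * p n) \<longlonglongrightarrow> c"
    then show "weakly_converges ?S (?e c)"
      unfolding weak_iff using p p_nonneg K c
      by (auto intro!: binomial_limit_compound_poisson borel_measurable_continuous_onI)
  qed
  moreover have "weakly_converges ?S (haar_measure ?H) \<longleftrightarrow>
      filterlim (\<lambda>n. real (K n) * p n) at_top sequentially" if cpt: "compact ?H"
  proof -
    note H = closed_smallest_closed_subgroup[of x] is_subgroup_smallest_closed_subgroup[of x]
    have haar: "is_normalized_haar ?H (haar_measure ?H)"
      by (rule is_normalized_haar_haar_measure[OF haus cpt])
    then have haar': "prob_space (haar_measure ?H)" "sets (haar_measure ?H) = sets borel"
      by (auto simp: is_normalized_haar_def)
    have inv: "distr (haar_measure ?H) borel ((+) x) = haar_measure ?H"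
      by (rule is_normalized_haar_imp_translation_invariant[OF haar H mem_smallest_closed_subgroup])
    show ?thesis
    proof
      assume "weakly_converges ?S (haar_measure ?H)"
      then have lim: "\<forall>f::'a \<Rightarrow> real. continuous_on UNIV f \<and> bounded (range f) \<longrightarrow>
          (\<lambda>n. ?E n f) \<longlonglongrightarrow> integral\<^sup>L (haar_measure ?H) f"
        unfolding weak_iff .
      have "(\<lambda>n. ereal (real (K n) * p n)) \<longlonglongrightarrow> \<infinity>"
      proof (rule tendsto_ereal_subsequence_limits)
        fix r l assume "strict_mono r" "(\<lambda>n. ereal (real (K (r n)) * p (r n))) \<longlonglongrightarrow> l"
        with p p_nonneg K haar' lim
        show "l = \<infinity>"
        proof (cases rule: binomial_weak_limit_cases)
          \<comment> \<open>A finite subsequence limit would make the Haar measure compound Poisson,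
            contrary to its invariance under \<open>x\<close>.\<close>
          case (finite d)
          then show ?thesis
            using compound_poisson_not_translation_invariant[OF sing x] inv by metis
        qed
      qed
      then show "filterlim (\<lambda>n. real (K n) * p n) at_top sequentially"
        by (simp add: tendsto_PInfty_eq_at_top)
    next
      assume Kp: "filterlim (\<lambda>n. real (K n) * p n) at_top sequentially"
      show "weakly_converges ?S (haar_measure ?H)"
        unfolding weak_iff
      proof (intro allI impI, elim conjE)
        fix f :: "'a \<Rightarrow> real" assume f: "continuous_on UNIV f" "bounded (range f)"
        \<comment> \<open>Passing to \<open>ereal\<close> makes the same criterion applicable: any
          convergent subsequence has a further one along which the limit is the Haar
          integral.\<close>
        have "(\<lambda>n. ereal (?E n f)) \<longlonglongrightarrow> ereal (integral\<^sup>L (haar_measure ?H) f)"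
        proof (rule tendsto_ereal_subsequence_limits)
          fix r l assume r: "strict_mono r" and l: "(\<lambda>n. ereal (?E (r n) f)) \<longlonglongrightarrow> l"
          have sub: "(\<lambda>n. p (r n)) \<longlonglongrightarrow> 0" "filterlim (\<lambda>n. real (K (r n)) * p (r n)) at_top sequentially"
            using filterlim_compose[OF p filterlim_subseq[OF r]] filterlim_compose[OF Kp filterlim_subseq[OF r]]
            by auto
          obtain s :: "nat \<Rightarrow> nat" and \<nu> :: "'a measure"
            where s: "strict_mono s" and \<nu>: "is_normalized_haar ?H \<nu>"
              and lim: "\<And>f::'a \<Rightarrow> real. continuous_on UNIV f \<Longrightarrow> bounded (range f) \<Longrightarrow>
                (\<lambda>n. ?E (r (s n)) f) \<longlonglongrightarrow> integral\<^sup>L \<nu> f"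
            by (rule binomial_compact_subsequence_haar[OF haus cpt sub], rule that)
          have "\<nu> = haar_measure ?H"
            by (rule is_normalized_haar_unique[OF \<nu> haar H])
          moreover have "(\<lambda>n. ereal (?E (r (s n)) f)) \<longlonglongrightarrow> l"
            by (rule filterlim_compose[OF l filterlim_subseq[OF s]])
          ultimately show "l = ereal (integral\<^sup>L (haar_measure ?H) f)"
            using tendsto_ereal[OF lim[OF f]] by (simp add: LIMSEQ_unique)
        qed
        then show "(\<lambda>n. ?E n f) \<longlonglongrightarrow> integral\<^sup>L (haar_measure ?H) f"
          by simp
      qed
    qed
  qed
  ultimately show ?thesis
    by blast
qed

end
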